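(* In the local setting described in the context (the singularity curve is locally the graph of a $C^3$ function $g$, the function $f$ equals $f_1\in C^2$ below it and $f_2\in C^2$ above it, and $|f_1-f_2|\ge\delta>0$ on the curve), let $(a,b,c)$ be the solution of the system of three quadratic equations $$Q_i(a,b,c)=\bar f_{i,4}+\bar f_{i,5}+\bar f_{i,6}+\bar f_{i,7},\qquad i=2,3,4,$$ obtained, for $h$ small enough, as the limit of Newton's iteration started at the coefficients $(\tilde a,\tilde b,\tilde c)$ of a quadratic $\tilde q(x)=\tilde ax^2+\tilde bx+\tilde ch$ satisfying $g=\tilde q+O(h^3)$ on $[h,4h]$. Let $q(x)=ax^2+bx+ch$. Then, as $h\to0$, $$q(x)=g(x)+O(h^3)\quad\text{uniformly for } x\in[2h,3h].$$
   Context: Setting. For each small $h>0$ consider the window $[h,4h]\times[h,9h]$, divided into cells $c_{i,j}=[(i-1)h,ih]\times[(j-1)h,jh]$, $2\le i\le4$, $2\le j\le9$. (It represents a neighborhood of a piece of a fixed smooth singularity curve of a fixed piecewise smooth function, after translating, and possibly exchanging or reflecting, the coordinate axes.) In the window the singularity curve $\Gamma$ is the graph $y=g(x)$ of a $C^3$ function $g:[h,4h]\to[3h,7h]$. The function $f$ equals $f_1\in C^2$ below $\Gamma$ and $f_2\in C^2$ above $\Gamma$. The $C^3$ norm of $g$ and the $C^2$ norms of $f_1,f_2$ are bounded independently of $h$, and $|f_1-f_2|\ge\delta>0$ on $\Gamma$ with $\delta$ independent of $h$. The data are the cell-averages $\bar f_{i,j}=h^{-2}\iint_{c_{i,j}}f\,dx\,dy$.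 Linear pieces. $L_1(x,y)=\alpha_1x+\beta_1y+\gamma_1$ is the linear polynomial whose cell-averages on $c_{3,2},c_{3,3},c_{4,3}$ equal $\bar f_{3,2},\bar f_{3,3},\bar f_{4,3}$. $L_2(x,y)=\alpha_2x+\beta_2y+\gamma_2$ is the linear polynomial whose cell-averages on $c_{3,9},c_{3,8},c_{4,8}$ equal $\bar f_{3,9},\bar f_{3,8},\bar f_{4,8}$. The mapping $Q$. For $(a,b,c)\in\mathbb{R}^3$ put $q(x)=ax^2+bx+ch$ and, for $i=2,3,4$, $$Q_i(a,b,c)=h^{-2}\Big(\int_{(i-1)h}^{ih}\int_{3h}^{q(x)}(L_1(x,y)-L_2(x,y))\,dy\,dx+\int_{(i-1)h}^{ih}\int_{3h}^{7h}L_2(x,y)\,dy\,dx\Big).$$ Let $Q=(Q_2,Q_3,Q_4)^t$, let $J_Q$ be its Jacobian with respect to $(a,b,c)$, and let $\bar F=(\bar f_{i,4}+\bar f_{i,5}+\bar f_{i,6}+\bar f_{i,7})_{i=2,3,4}$. Newton's iteration is $v^{[n+1]}=v^{[n]}-J_Q(v^{[n]})^{-1}(Q(v^{[n]})-\bar F)$ with $v^{[0]}=(\tilde a,\tilde b,\tilde c)^t$. The numbers $\tilde a,\tilde b,\tilde c$ are $O(1)$ as $h\to0$. Constants in $O(\cdot)$ are independent of $h$. *)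

theory Defs
  imports "HOL-Analysis.Analysis"
begin

(* D i is the i-th derivative (one-sided at boundary points of S); the last clause says
   that the C^k norm is at most M. *)
definition Ck_norm_le1 :: "nat \<Rightarrow> real set \<Rightarrow> (real \<Rightarrow> real) \<Rightarrow> real \<Rightarrow> bool" where
  "Ck_norm_le1 k S g M \<longleftrightarrow> (\<exists>D :: nat \<Rightarrow> real \<Rightarrow> real.
     D 0 = g \<and>
     (\<forall>i<k. \<forall>x\<in>S. (D i has_real_derivative D (Suc i) x) (at x within S)) \<and>
     (\<forall>i\<le>k. continuous_on S (D i)) \<and>
     (\<forall>i\<le>k. \<forall>x\<in>S. \<bar>D i x\<bar> \<le> M))"

(* D i j is the partial derivative taken i times in x and j times in y. On a closed S the
   derivatives are taken within S, i.e. f is C^k up to the boundary of S. *)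
definition Ck_norm_le2 :: "nat \<Rightarrow> (real \<times> real) set \<Rightarrow> (real \<times> real \<Rightarrow> real) \<Rightarrow> real \<Rightarrow> bool" where
  "Ck_norm_le2 k S f M \<longleftrightarrow> (\<exists>D :: nat \<Rightarrow> nat \<Rightarrow> real \<times> real \<Rightarrow> real.
     D 0 0 = f \<and>
     (\<forall>i j. i + j < k \<longrightarrow> (\<forall>p\<in>S. (D i j has_derivative
        (\<lambda>(u, v). D (Suc i) j p * u + D i (Suc j) p * v)) (at p within S))) \<and>
     (\<forall>i j. i + j \<le> k \<longrightarrow> continuous_on S (D i j)) \<and>
     (\<forall>i j. i + j \<le> k \<longrightarrow> (\<forall>p\<in>S. \<bar>D i j p\<bar> \<le> M)))"

definition window :: "real \<Rightarrow> (real \<times> real) set" where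
  "window h = {h..4*h} \<times> {h..9*h}"

definition cell :: "real \<Rightarrow> nat \<Rightarrow> nat \<Rightarrow> (real \<times> real) set" where
  "cell h i j = {(real i - 1) * h..real i * h} \<times> {(real j - 1) * h..real j * h}"

(* The gauge integral ignores the values of f on the (null) curve, which are unspecified. *)
definition cell_avg :: "real \<Rightarrow> (real \<times> real \<Rightarrow> real) \<Rightarrow> nat \<Rightarrow> nat \<Rightarrow> real" where
  "cell_avg h f i j = integral (cell h i j) f / h^2"

definition local_setting ::
  "real \<Rightarrow> real \<Rightarrow> real \<Rightarrow> (real \<Rightarrow> real) \<Rightarrow> (real \<times> real \<Rightarrow> real) \<Rightarrow> (real \<times> real \<Rightarrow> real) \<Rightarrow>
    (real \<times> real \<Rightarrow> real) \<Rightarrow> bool" where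
  "local_setting M \<delta> h g f1 f2 f \<longleftrightarrow>
     Ck_norm_le1 3 {h..4*h} g M \<and>
     g ` {h..4*h} \<subseteq> {3*h..7*h} \<and>
     Ck_norm_le2 2 {(x, y) \<in> window h. y \<le> g x} f1 M \<and>
     Ck_norm_le2 2 {(x, y) \<in> window h. g x \<le> y} f2 M \<and>
     (\<forall>(x, y) \<in> window h. (y < g x \<longrightarrow> f (x, y) = f1 (x, y)) \<and> (g x < y \<longrightarrow> f (x, y) = f2 (x, y))) \<and>
     (\<forall>x\<in>{h..4*h}. \<delta> \<le> \<bar>f1 (x, g x) - f2 (x, g x)\<bar>)"

definition linear_piece ::
  "real \<Rightarrow> (real \<times> real \<Rightarrow> real) \<Rightarrow> (nat \<times> nat) set \<Rightarrow> (real \<times> real \<Rightarrow> real) \<Rightarrow> bool" where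
  "linear_piece h f I L \<longleftrightarrow>
     (\<exists>\<alpha> \<beta> \<gamma>. L = (\<lambda>(x, y). \<alpha> * x + \<beta> * y + \<gamma>)) \<and>
     (\<forall>(i, j) \<in> I. cell_avg h L i j = cell_avg h f i j)"

definition quad :: "real \<Rightarrow> real^3 \<Rightarrow> real \<Rightarrow> real" where
  "quad h v x = v$1 * x^2 + v$2 * x + v$3 * h"

(* LBINT is the oriented integral: the graph of quad h v may dip below the line y = 3h. *)
definition Q_comp ::
  "real \<Rightarrow> (real \<times> real \<Rightarrow> real) \<Rightarrow> (real \<times> real \<Rightarrow> real) \<Rightarrow> nat \<Rightarrow> real^3 \<Rightarrow> real" where
  "Q_comp h L1 L2 i v =
     ((LBINT x=(real i - 1)*h..real i * h. (LBINT y=3*h..quad h v x. L1 (x, y) - L2 (x, y))) +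
      (LBINT x=(real i - 1)*h..real i * h. (LBINT y=3*h..7*h. L2 (x, y)))) / h^2"

definition Q ::
  "real \<Rightarrow> (real \<times> real \<Rightarrow> real) \<Rightarrow> (real \<times> real \<Rightarrow> real) \<Rightarrow> real^3 \<Rightarrow> real^3" where
  "Q h L1 L2 v = vector [Q_comp h L1 L2 2 v, Q_comp h L1 L2 3 v, Q_comp h L1 L2 4 v]"

definition col_data :: "real \<Rightarrow> (real \<times> real \<Rightarrow> real) \<Rightarrow> nat \<Rightarrow> real" where
  "col_data h f i = cell_avg h f i 4 + cell_avg h f i 5 + cell_avg h f i 6 + cell_avg h f i 7"

definition Fbar :: "real \<Rightarrow> (real \<times> real \<Rightarrow> real) \<Rightarrow> real^3" where
  "Fbar h f = vector [col_data h f 2, col_data h f 3, col_data h f 4]"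

primrec newton :: "(real^3 \<Rightarrow> real^3) \<Rightarrow> real^3 \<Rightarrow> real^3 \<Rightarrow> nat \<Rightarrow> real^3" where
  "newton G F v0 0 = v0"
| "newton G F v0 (Suc n) = newton G F v0 n -
     matrix_inv (jacobian G (at (newton G F v0 n))) *v (G (newton G F v0 n) - F)"

end

theory Submission
  imports Defs
begin

text \<open>
  Second-order Taylor expansion on either side of the curve shows that \<open>L1\<close> and \<open>L2\<close> approximate
  \<open>f1\<close> and \<open>f2\<close> up to \<open>O(h^2)\<close> on their whole regions. Therefore the residual of the
  system at the starting point, whose parabola is \<open>O(h^3)\<close>-close to the curve, is \<open>O(h^2)\<close>.

  Measure a coefficient vector \<open>w\<close> by \<open>h * \<bar>w$1\<bar> + \<bar>w$2\<bar> + \<bar>w$3\<bar>\<close>. The derivative of \<open>Q\<close> in direction \<open>w\<close>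
  consists of the integrals of \<open>(L1 - L2) * quad h w\<close> along the current parabola over the three columns.
  Since \<open>L1 - L2\<close> is a constant of modulus at least \<open>\<delta> / 2\<close> up to \<open>O(h)\<close> there, and a quadratic is
  determined by its means over three adjacent intervals, the inverse of the derivative is bounded independently of \<open>h\<close>,
  whereas the quadratic part of \<open>Q\<close> is \<open>O(h)\<close>. So Newton's iteration converges and moves by \<open>O(h^2)\<close>
  in this norm, which changes the parabola by \<open>O(h^3)\<close> only.
\<close>

section \<open>Newton iteration for a quadratic map\<close>

text \<open>\<open>matrix_inv\<close> is defined by choice, so a Newton step solves the linearized
  equation only where the Jacobian is known to be invertible. For a square matrix a trivial kernel
  suffices.\<close>

lemma invertible_jacobian_if_injective:
  fixes G :: "real^'n \<Rightarrow> real^'n"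
  assumes der: "(G has_derivative G') (at v)" and inj: "\<And>w. G' w = 0 \<Longrightarrow> w = 0"
  shows "invertible (jacobian G (at v))"
    and "G' (matrix_inv (jacobian G (at v)) *v u) = u"
proof -
  have J: "(\<lambda>w. jacobian G (at v) *v w) = G'"
    using der jacobian_works differentiable_def has_derivative_unique by blast
  have "inj ((*v) (jacobian G (at v)))"
    unfolding linear_injective_0[OF matrix_vector_mul_linear] using inj J by metis
  then show inv: "invertible (jacobian G (at v))"
    unfolding invertible_left_inverse matrix_left_invertible_injective .
  then have "jacobian G (at v) ** matrix_inv (jacobian G (at v)) = mat 1"
    unfolding invertible_def matrix_inv_def
    by (metis (mono_tags, lifting) someI_ex)
  then show "G' (matrix_inv (jacobian G (at v)) *v u) = u"
    by (metis J matrix_vector_mul_assoc matrix_vector_mul_lid)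
qed

text \<open>Differentiability is read off the remainder estimate: divided by \<open>norm w\<close>,
  the remainder is at most \<open>k * norm w\<close>.\<close>

lemma has_derivative_quadratic_remainder:
  fixes G :: "'a::euclidean_space \<Rightarrow> 'b::real_normed_vector"
  assumes "linear G'" and rem: "\<And>w. norm (G (v + w) - G v - G' w) \<le> k * (norm w)\<^sup>2"
  shows "(G has_derivative G') (at v)"
proof -
  have "(\<lambda>w. norm (G (v + w) - G v - G' w) / norm w) \<midarrow>0\<rightarrow> 0"
  proof (rule Lim_null_comparison)
    have "\<bar>norm (G (v + w) - G v - G' w) / norm w\<bar> \<le> k * norm w" if "w \<noteq> 0" for w
      using rem[of w] that by (simp add: field_simps power2_eq_square)
    then show "\<forall>\<^sub>F w in at 0. norm (norm (G (v + w) - G v - G' w) / norm w) \<le> k * norm w"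
      by (auto simp: eventually_at_filter)
    show "((\<lambda>w. k * norm w) \<longlongrightarrow> 0) (at (0::'a))"
      by (rule tendsto_eq_intros | simp)+
  qed
  then show ?thesis
    unfolding has_derivative_at using assms(1) linear_conv_bounded_linear by blast
qed

text \<open>A Newton step cancels the linear part of the expansion, so the new residual is the
  remainder, at most \<open>k * (N w)^2\<close>. With \<open>C * k \<le> 1\<close> and steps of size
  at most 1/2, the scaled residual \<open>C * norm (G v - F)\<close> at least halves. Hence the
  steps are summable and the iterates stay within distance \<open>2 * \<eta> \<le> 1\<close> of
  \<open>v0\<close>, where \<open>inv\<close> applies. The constants \<open>c\<close> and
  \<open>c'\<close> only compare topologies, so they may degenerate as the mesh size tends to
  0.\<close>

lemma newton_quadratic_convergence:
  fixes G :: "real^3 \<Rightarrow> real^3" and N :: "real^3 \<Rightarrow> real"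
  assumes N0: "N 0 = 0" and N_minus: "\<And>x. N (- x) = N x"
    and N_add: "\<And>x y. N (x + y) \<le> N x + N y"
    and N_cont: "continuous_on UNIV N" and norm_le_N: "\<And>x. norm x \<le> c * N x"
    and lin: "\<And>v. linear (G' v)" and "k \<ge> 0" "C \<ge> 0"
    and rem: "\<And>v w. norm (G (v + w) - G v - G' v w) \<le> k * (N w)\<^sup>2"
    and N_le: "\<And>w. N w \<le> c' * norm w"
    and inv: "\<And>v w. N (v - v0) \<le> 1 \<Longrightarrow> N w \<le> C * norm (G' v w)"
    and init: "C * norm (G v0 - F) \<le> \<eta>" "\<eta> \<le> 1/2" and small: "C * k \<le> 1"
  shows "\<forall>n. invertible (jacobian G (at (newton G F v0 n)))"
    and "\<exists>l. newton G F v0 \<longlonglongrightarrow> l \<and> G l = F \<and> N (l - v0) \<le> 2 * \<eta>"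
proof -
  define v where "v = newton G F v0"
  define w where "w n = v (Suc n) - v n" for n
  have N_nonneg: "0 \<le> N x" for x using N_add[of x "- x"] N0 N_minus[of x] by simp
  have der: "(G has_derivative G' u) (at u)" for u
  proof (rule has_derivative_quadratic_remainder[OF lin])
    fix z
    have "(N z)\<^sup>2 \<le> (c' * norm z)\<^sup>2" using N_le N_nonneg by (intro power_mono)
    with rem[of u z] \<open>k \<ge> 0\<close> show "norm (G (u + z) - G u - G' u z) \<le> (k * c'\<^sup>2) * (norm z)\<^sup>2"
      by (smt (verit) mult.assoc mult_left_mono power_mult_distrib)
  qed
  have inj: "z = 0" if "N (u - v0) \<le> 1" "G' u z = 0" for u z
  proof -
    have "N z \<le> 0" using inv[OF that(1), of z] that(2) by simp
    then have "N z = 0" using N_nonneg[of z] by simp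
    then show ?thesis using norm_le_N[of z] by simp
  qed
  have step: "G' (v n) (w n) = F - G (v n)" if "N (v n - v0) \<le> 1" for n
  proof -
    have "w n = matrix_inv (jacobian G (at (v n))) *v (F - G (v n))"
      unfolding w_def v_def by (simp add: matrix_vector_mult_diff_distrib)
    then show ?thesis
      using invertible_jacobian_if_injective(2)[OF der inj[OF that]] by simp
  qed
  have eta0: "0 \<le> \<eta>"
    using init(1) \<open>C \<ge> 0\<close> by (meson mult_nonneg_nonneg norm_ge_zero order_trans)
  \<comment> \<open>\<open>2 * \<eta> * (1 - (1/2)^m)\<close> is the sum of
    \<open>\<eta> * (1/2)^i\<close> over \<open>i < m\<close>, which bounds the distance travelled
    in \<open>m\<close> steps.\<close>
  have bd': "2 * \<eta> * (1 - (1/2)^m) \<le> 2 * \<eta>" for m :: nat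
    using eta0 by (intro mult_left_le) auto
  have bd: "2 * \<eta> * (1 - (1/2)^m) \<le> 1" for m :: nat
    using order_trans[OF bd'] init(2) by simp
  have main: "N (v n - v0) \<le> 2 * \<eta> * (1 - (1/2)^n) \<and> N (w n) \<le> \<eta> * (1/2)^n
     \<and> C * norm (G (v n) - F) \<le> \<eta> * (1/2)^n" for n
  proof (induction n)
    case 0
    have [simp]: "v 0 = v0" by (simp add: v_def)
    have "N (v 0 - v0) \<le> 1" by (simp add: N0)
    then have "N (w 0) \<le> C * norm (G v0 - F)"
      using inv[of "v 0" "w 0"] step[of 0] by (simp add: norm_minus_commute)
    with init show ?case by (simp add: N0)
  next
    case (Suc n)
    have 1: "N (v n - v0) \<le> 1" using Suc bd[of n] by linarith
    have "v (Suc n) - v0 = (v n - v0) + w n" by (simp add: w_def)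
    then have "N (v (Suc n) - v0) \<le> N (v n - v0) + N (w n)" using N_add by metis
    then have 2: "N (v (Suc n) - v0) \<le> 2 * \<eta> * (1 - (1/2)^Suc n)" using Suc by (simp add: algebra_simps)
    have 3: "N (v (Suc n) - v0) \<le> 1" using 2 bd[of "Suc n"] by linarith
    have "norm (G (v (Suc n)) - F) \<le> k * (N (w n))\<^sup>2"
      using rem[of "v n" "w n"] step[OF 1] by (simp add: w_def algebra_simps)
    then have "C * norm (G (v (Suc n)) - F) \<le> (C * k) * (N (w n))\<^sup>2"
      using \<open>C \<ge> 0\<close> by (metis mult.assoc mult_left_mono)
    also have "\<dots> \<le> 1 * (N (w n))\<^sup>2" using small by (intro mult_right_mono) auto
    also have "\<dots> = N (w n) * N (w n)" by (simp add: power2_eq_square)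
    \<comment> \<open>One factor \<open>N (w n)\<close> decays geometrically by the induction
      hypothesis; the other, bounded by 1/2, supplies the halving.\<close>
    also have "\<dots> \<le> (\<eta> * (1/2)^n) * (1/2)"
    proof (intro mult_mono)
      have "\<eta> * (1/2)^n \<le> \<eta> * 1" using eta0 by (intro mult_left_mono) (auto simp: power_le_one)
      then show "N (w n) \<le> 1/2" using Suc init(2) by linarith
    qed (use Suc eta0 N_nonneg in auto)
    finally have 4: "C * norm (G (v (Suc n)) - F) \<le> \<eta> * (1/2)^Suc n" by simp
    have "N (w (Suc n)) \<le> C * norm (G (v (Suc n)) - F)"
      using inv[OF 3, of "w (Suc n)"] step[OF 3] by (simp add: norm_minus_commute)
    with 2 4 show ?case by linarith
  qed
  have ball: "N (v n - v0) \<le> 2 * \<eta>" for n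
    using main[of n] order_trans[OF _ bd'[of n]] by simp
  then have ball1: "N (v n - v0) \<le> 1" for n using init(2) ball[of n] by linarith
  show "\<forall>n. invertible (jacobian G (at (newton G F v0 n)))"
    using invertible_jacobian_if_injective(1)[OF der inj[OF ball1]] by (simp add: v_def)
  have c0: "norm (w n) \<le> \<bar>c\<bar> * \<eta> * (1/2)^n" for n
  proof -
    have "norm (w n) \<le> \<bar>c\<bar> * N (w n)"
      using order_trans[OF norm_le_N mult_right_mono[OF abs_ge_self N_nonneg]] .
    also have "\<dots> \<le> \<bar>c\<bar> * (\<eta> * (1/2)^n)" using main[of n] by (intro mult_left_mono) auto
    finally show ?thesis by (simp add: mult.assoc)
  qed
  have "summable w"
    by (rule summable_comparison_test'[where g = "\<lambda>n. \<bar>c\<bar> * \<eta> * (1/2)^n" and N = 0])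
      (use c0 in \<open>auto intro!: summable_mult summable_geometric\<close>)
  then have "(\<lambda>n. \<Sum>i<n. w i) \<longlonglongrightarrow> suminf w" by (rule summable_LIMSEQ)
  moreover have "(\<Sum>i<n. w i) = v n - v0" for n
    unfolding w_def by (induction n) (auto simp: v_def)
  ultimately have "(\<lambda>n. (v n - v0) + v0) \<longlonglongrightarrow> suminf w + v0"
    by (intro tendsto_add) auto
  then obtain l where l: "v \<longlonglongrightarrow> l" by auto
  have "(\<lambda>n. C * norm (G (v n) - F)) \<longlonglongrightarrow> C * norm (G l - F)"
    using isCont_tendsto_compose[OF has_derivative_continuous[OF der] l] by (intro tendsto_intros)
  moreover have "(\<lambda>n. C * norm (G (v n) - F)) \<longlonglongrightarrow> 0"
  proof (rule Lim_null_comparison)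
    show "\<forall>\<^sub>F n in sequentially. norm (C * norm (G (v n) - F)) \<le> \<eta> * (1/2)^n"
      using main \<open>C \<ge> 0\<close> by simp
    show "(\<lambda>n. \<eta> * (1/2)^n) \<longlonglongrightarrow> 0" by (intro tendsto_mult_right_zero LIMSEQ_realpow_zero) auto
  qed
  ultimately have CG: "C * norm (G l - F) = 0" using LIMSEQ_unique by blast
  have lN: "(\<lambda>n. N (v n - v0)) \<longlonglongrightarrow> N (l - v0)"
    using l N_cont by (intro continuous_on_tendsto_compose[OF N_cont] tendsto_intros) auto
  then have Nl: "N (l - v0) \<le> 2 * \<eta>" using ball LIMSEQ_le_const2 by blast
  have "G l = F"
  \<comment> \<open>\<open>CG\<close> determines \<open>G l\<close> only for nonzero
    \<open>C\<close>. For \<open>C = 0\<close>, \<open>inv\<close> would make \<open>N\<close>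
    vanish at a unit vector, which \<open>norm_le_N\<close> excludes.\<close>
  proof (cases "C = 0")
    case True
    have "N (axis 1 1) = 0"
      using inv[of v0 "axis 1 1"] N_nonneg[of "axis 1 1"] True by (simp add: N0)
    then have "norm (axis 1 1 :: real^3) \<le> 0" using norm_le_N[of "axis 1 1"] by simp
    then show ?thesis by (simp add: axis_eq_0_iff)
  qed (use CG in simp)
  with l Nl show "\<exists>l. newton G F v0 \<longlonglongrightarrow> l \<and> G l = F \<and> N (l - v0) \<le> 2 * \<eta>"
    unfolding v_def by blast
qed

section \<open>Affine approximation\<close>

text \<open>Mean value inequality for \<open>\<phi> t - c * t\<close>. With \<open>c = 0\<close> it
  yields Lipschitz bounds, with \<open>c\<close> the slope at a base point the second-order Taylor
  estimate.\<close>

lemma affine_approx_on_segment: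
  fixes \<phi> \<phi>' :: "real \<Rightarrow> real"
  assumes "\<And>t. t \<in> closed_segment a b \<Longrightarrow> (\<phi> has_real_derivative \<phi>' t) (at t within closed_segment a b)"
    and "\<And>t. t \<in> closed_segment a b \<Longrightarrow> \<bar>\<phi>' t - c\<bar> \<le> B"
  shows "\<bar>\<phi> b - \<phi> a - c * (b - a)\<bar> \<le> B * \<bar>b - a\<bar>"
proof -
  have "norm ((\<phi> b - c * b) - (\<phi> a - c * a)) \<le> B * norm (b - a)"
    by (rule field_differentiable_bound[of "closed_segment a b" "\<lambda>t. \<phi> t - c * t" "\<lambda>t. \<phi>' t - c"])
      (use assms in \<open>auto intro!: derivative_eq_intros\<close>)
  then show ?thesis by (simp add: algebra_simps)
qed

text \<open>The region on one side of the curve need not be convex, so each point is reached from the base point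
  \<open>(h, y0)\<close> along a horizontal and then a vertical segment.\<close>

lemma C2_affine_approx:
  assumes f: "Ck_norm_le2 2 S f M" and S: "S \<subseteq> window h" and h: "0 \<le> h"
    and y0: "h \<le> y0" "y0 \<le> 9 * h"
    and base: "\<And>x. x \<in> {h..4*h} \<Longrightarrow> (x, y0) \<in> S"
    and vert: "\<And>x y t. (x, y) \<in> S \<Longrightarrow> t \<in> closed_segment y0 y \<Longrightarrow> (x, t) \<in> S"
  shows "\<exists>a b c. \<bar>a\<bar> \<le> M \<and> \<bar>b\<bar> \<le> M \<and>
    (\<forall>(x, y)\<in>S. \<bar>f (x, y) - (a * x + b * y + c)\<bar> \<le> 97 * M * h\<^sup>2)"
proof -
  obtain D where D0: "D 0 0 = f"
    and D: "\<And>i j p. i + j < 2 \<Longrightarrow> p \<in> S \<Longrightarrow> (D i j has_derivative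
        (\<lambda>(u, v). D (Suc i) j p * u + D i (Suc j) p * v)) (at p within S)"
    and bd: "\<And>i j p. i + j \<le> 2 \<Longrightarrow> p \<in> S \<Longrightarrow> \<bar>D i j p\<bar> \<le> M"
    using f unfolding Ck_norm_le2_def by metis
  have Dx: "((\<lambda>s. D i j (s, y)) has_real_derivative D (Suc i) j (x, y)) (at x within A)"
    if "i + j < 2" "x \<in> A" "\<And>s. s \<in> A \<Longrightarrow> (s, y) \<in> S" for i j x y A
  proof -
    have "((D i j \<circ> (\<lambda>s. (s, y))) has_derivative
        (\<lambda>(u, v). D (Suc i) j (x, y) * u + D i (Suc j) (x, y) * v) \<circ> (\<lambda>s. (s, 0))) (at x within A)"
      by (rule diff_chain_within)
        (use that in \<open>auto intro!: derivative_eq_intros has_derivative_subset[OF D]\<close>)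
    then show ?thesis by (simp add: has_field_derivative_def o_def)
  qed
  have Dy: "((\<lambda>s. D i j (x, s)) has_real_derivative D i (Suc j) (x, y)) (at y within A)"
    if "i + j < 2" "y \<in> A" "\<And>s. s \<in> A \<Longrightarrow> (x, s) \<in> S" for i j x y A
  proof -
    have "((D i j \<circ> (\<lambda>s. (x, s))) has_derivative
        (\<lambda>(u, v). D (Suc i) j (x, y) * u + D i (Suc j) (x, y) * v) \<circ> (\<lambda>s. (0, s))) (at y within A)"
      by (rule diff_chain_within)
        (use that in \<open>auto intro!: derivative_eq_intros has_derivative_subset[OF D]\<close>)
    then show ?thesis by (simp add: has_field_derivative_def o_def)
  qed
  have lipx: "\<bar>D i j (x, y0) - D i j (h, y0)\<bar> \<le> M * (3 * h)"
    if "i + j < 2" "x \<in> {h..4*h}" for i j x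
  proof -
    have sub: "closed_segment h x \<subseteq> {h..4*h}" using that by (auto simp: closed_segment_eq_real_ivl)
    have "\<bar>D i j (x, y0) - D i j (h, y0) - 0 * (x - h)\<bar> \<le> M * \<bar>x - h\<bar>"
      by (rule affine_approx_on_segment[where \<phi> = "\<lambda>s. D i j (s, y0)", OF Dx])
        (use that sub base in \<open>auto intro!: bd\<close>)
    also have "\<dots> \<le> M * (3 * h)"
      using bd[of 0 0 "(x, y0)"] base that by (intro mult_left_mono) auto
    finally show ?thesis by simp
  qed
  have lipy: "\<bar>D i j (x, y) - D i j (x, y0)\<bar> \<le> M * (8 * h)"
    if "i + j < 2" "(x, y) \<in> S" for i j x y
  proof -
    have yy: "y \<in> {h..9*h}" using that S by (auto simp: window_def)
    have "\<bar>D i j (x, y) - D i j (x, y0) - 0 * (y - y0)\<bar> \<le> M * \<bar>y - y0\<bar>"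
      by (rule affine_approx_on_segment[where \<phi> = "\<lambda>s. D i j (x, s)", OF Dy])
        (use that vert in \<open>auto intro!: bd\<close>)
    also have "\<dots> \<le> M * (8 * h)"
      using bd[of 0 0 "(x, y)"] that y0 yy by (intro mult_left_mono) (auto simp: abs_le_iff)
    finally show ?thesis by simp
  qed
  \<comment> \<open>The affine function is the Taylor polynomial at \<open>(h, y0)\<close>. On the
    horizontal leg, of length at most \<open>3 * h\<close>, the slope deviates by at most
    \<open>3 * M * h\<close>; on the vertical leg, of length at most \<open>8 * h\<close>, by
    \<open>(3 + 8) * M * h\<close>, because it is compared with the slope at the base point. This
    gives 97 = 3 * 3 + 11 * 8.\<close>
  define a b c where "a = D 1 0 (h, y0)" and "b = D 0 1 (h, y0)" and "c = f (h, y0) - a * h - b * y0"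
  have "\<bar>f (x, y) - (a * x + b * y + c)\<bar> \<le> 97 * M * h\<^sup>2" if xy: "(x, y) \<in> S" for x y
  proof -
    have M: "0 \<le> M" using bd[of 0 0 "(x, y)"] xy by simp
    have x: "x \<in> {h..4*h}" and y: "y \<in> {h..9*h}" using xy S by (auto simp: window_def)
    have sub: "closed_segment h x \<subseteq> {h..4*h}" using x by (auto simp: closed_segment_eq_real_ivl)
    have "\<bar>D 0 0 (x, y0) - D 0 0 (h, y0) - a * (x - h)\<bar> \<le> M * (3 * h) * \<bar>x - h\<bar>"
      by (rule affine_approx_on_segment[where \<phi> = "\<lambda>s. D 0 0 (s, y0)", OF Dx])
        (use sub base lipx[of 1 0] in \<open>auto simp: a_def\<close>)
    also have "\<dots> \<le> M * (3 * h) * (3 * h)" using x M by (intro mult_left_mono) auto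
    finally have 1: "\<bar>D 0 0 (x, y0) - D 0 0 (h, y0) - a * (x - h)\<bar> \<le> 9 * M * h\<^sup>2"
      by (simp add: power2_eq_square algebra_simps)
    have "\<bar>D 0 0 (x, y) - D 0 0 (x, y0) - b * (y - y0)\<bar> \<le> (11 * M * h) * \<bar>y - y0\<bar>"
    proof (rule affine_approx_on_segment[where \<phi> = "\<lambda>s. D 0 0 (x, s)", OF Dy])
      fix t assume "t \<in> closed_segment y0 y"
      then have "\<bar>D 0 1 (x, t) - D 0 1 (x, y0)\<bar> \<le> M * (8 * h)" using lipy vert[OF xy] by simp
      moreover have "\<bar>D 0 1 (x, y0) - b\<bar> \<le> M * (3 * h)" using lipx[of 0 1] x by (simp add: b_def)
      ultimately show "\<bar>D 0 (Suc 0) (x, t) - b\<bar> \<le> 11 * M * h" by simp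
    qed (use vert[OF xy] in auto)
    also have "\<dots> \<le> (11 * M * h) * (8 * h)" using y y0 M h by (intro mult_left_mono) auto
    finally have 2: "\<bar>D 0 0 (x, y) - D 0 0 (x, y0) - b * (y - y0)\<bar> \<le> 88 * M * h\<^sup>2"
      by (simp add: power2_eq_square algebra_simps)
    have "f (x, y) - (a * x + b * y + c) = (D 0 0 (x, y) - D 0 0 (x, y0) - b * (y - y0))
        + (D 0 0 (x, y0) - D 0 0 (h, y0) - a * (x - h))"
      by (simp add: c_def D0 algebra_simps)
    with 1 2 show ?thesis by linarith
  qed
  moreover have "\<bar>a\<bar> \<le> M" "\<bar>b\<bar> \<le> M" using bd base[of h] h by (auto simp: a_def b_def)
  ultimately show ?thesis by blast
qed

section \<open>Averages of affine functions over cells\<close>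

lemma integral_affine:
  fixes p q a b :: real
  assumes "a \<le> b"
  shows "integral {a..b} (\<lambda>x. p * x + q) = p * (b\<^sup>2 - a\<^sup>2) / 2 + q * (b - a)"
proof -
  have "((\<lambda>x. p * x + q) has_integral (p * b\<^sup>2 / 2 + q * b) - (p * a\<^sup>2 / 2 + q * a)) {a..b}"
    by (rule fundamental_theorem_of_calculus[OF assms])
      (auto intro!: derivative_eq_intros simp flip: has_real_derivative_iff_has_vector_derivative)
  then show ?thesis by (simp add: integral_unique algebra_simps diff_divide_distrib)
qed

lemma cell_eq_cbox: "cell h i j = cbox ((real i - 1) * h, (real j - 1) * h) (real i * h, real j * h)"
  by (simp add: cell_def cbox_Pair_eq)

text \<open>The linear terms average out about the cell centre, so prescribing cell averages of an
  affine function means prescribing its values at the centres.\<close>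

lemma cell_avg_affine:
  assumes "0 < h"
  shows "cell_avg h (\<lambda>(x, y). a * x + b * y + c) i j = a * ((real i - 1/2) * h) + b * ((real j - 1/2) * h) + c"
proof -
  have "integral (cell h i j) (\<lambda>(x, y). a * x + b * y + c) =
    integral {(real i - 1) * h..real i * h} (\<lambda>x. integral {(real j - 1) * h..real j * h} (\<lambda>y. b * y + (a * x + c)))"
    unfolding cell_eq_cbox
    by (subst integral_prod_continuous) (auto intro!: continuous_intros simp: case_prod_unfold algebra_simps)
  also have "\<dots> = integral {(real i - 1) * h..real i * h} (\<lambda>x. (a * h) * x + h * (b * ((real j - 1/2) * h) + c))"
    using assms by (subst integral_affine) (auto simp: algebra_simps power2_eq_square diff_divide_distrib)
  also have "\<dots> = h\<^sup>2 * (a * ((real i - 1/2) * h) + b * ((real j - 1/2) * h) + c)"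
    using assms by (subst integral_affine) (auto simp: field_simps power2_eq_square)
  finally show ?thesis using assms by (simp add: cell_avg_def)
qed

text \<open>The two triples of cells share this L shape, up to a reflection in the second coordinate.\<close>

lemma affine_bound_from_L_shape:
  fixes a b c h e s y0 :: real
  assumes h: "0 < h" and s: "\<bar>s\<bar> = 1"
    and 1: "\<bar>a * (5/2 * h) + b * ((y0 + s) * h) + c\<bar> \<le> e"
    and 2: "\<bar>a * (5/2 * h) + b * (y0 * h) + c\<bar> \<le> e"
    and 3: "\<bar>a * (7/2 * h) + b * (y0 * h) + c\<bar> \<le> e"
    and y0: "5/2 \<le> y0" "y0 \<le> 15/2"
  shows "\<bar>a\<bar> * h \<le> 2 * e" "\<bar>b\<bar> * h \<le> 2 * e"
    and "(x, y) \<in> window h \<Longrightarrow> \<bar>a * x + b * y + c\<bar> \<le> 17 * e"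
proof -
  have "\<bar>a * h\<bar> \<le> 2 * e" using 2 3 by (simp add: algebra_simps abs_le_iff)
  then show A: "\<bar>a\<bar> * h \<le> 2 * e" using h by (simp add: abs_mult)
  have "\<bar>b * (s * h)\<bar> \<le> 2 * e" using 1 2 by (simp add: algebra_simps abs_le_iff)
  then show B: "\<bar>b\<bar> * h \<le> 2 * e" using h s by (simp add: abs_mult)
  \<comment> \<open>Expansion about the corner of the L. Points of the window are within
    \<open>3/2 * h\<close> and \<open>13/2 * h\<close> of it in the two coordinates, and the slopes
    times \<open>h\<close> are at most \<open>2 * e\<close>, whence 17 = 3 + 13 + 1.\<close>
  show "\<bar>a * x + b * y + c\<bar> \<le> 17 * e" if "(x, y) \<in> window h"
  proof -
    have "5/2 * h \<le> y0 * h" "y0 * h \<le> 15/2 * h" using y0 h by (auto intro!: mult_right_mono)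
    moreover have "h \<le> x" "x \<le> 4 * h" "h \<le> y" "y \<le> 9 * h" using that by (auto simp: window_def)
    ultimately have "\<bar>x - 5/2 * h\<bar> \<le> 3/2 * h" "\<bar>y - y0 * h\<bar> \<le> 13/2 * h"
      unfolding abs_le_iff by (simp; linarith)+
    then have "\<bar>a * (x - 5/2 * h)\<bar> \<le> \<bar>a\<bar> * (3/2 * h)" "\<bar>b * (y - y0 * h)\<bar> \<le> \<bar>b\<bar> * (13/2 * h)"
      unfolding abs_mult by (intro mult_left_mono; simp)+
    moreover have "\<bar>a\<bar> * (3/2 * h) \<le> 3 * e" "\<bar>b\<bar> * (13/2 * h) \<le> 13 * e" using A B by linarith+
    moreover have "a * x + b * y + c =
      a * (x - 5/2 * h) + b * (y - y0 * h) + (a * (5/2 * h) + b * (y0 * h) + c)"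
      by (simp add: algebra_simps)
    ultimately show ?thesis using 2 by linarith
  qed
qed

section \<open>Integrals over the columns\<close>

text \<open>Each branch is continuous on a compact set; cutting \<open>S\<close> along
  \<open>A\<close> glues them even across a jump.\<close>

lemma set_integrable_piecewise:
  fixes u w :: "'a::euclidean_space \<Rightarrow> real"
  assumes "compact A" "compact B" "continuous_on A u" "continuous_on B w"
    and S: "S \<in> sets borel" "S \<subseteq> A \<union> B"
  shows "set_integrable lborel S (\<lambda>p. if p \<in> A then u p else w p)" (is "set_integrable _ _ ?F")
proof -
  have [measurable]: "A \<in> sets borel" "B \<in> sets borel" "S \<in> sets borel"
    using assms borel_compact by auto
  have "set_integrable lborel A u" "set_integrable lborel B w"
    unfolding set_integrable_def using assms borel_integrable_compact by blast+
  then have "set_integrable lborel (S \<inter> A) u" "set_integrable lborel (S - A) w"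
    using S by (auto elim!: set_integrable_subset)
  then have "set_integrable lborel (S \<inter> A) ?F" "set_integrable lborel (S - A) ?F"
    using set_integrable_cong[of lborel lborel "S \<inter> A" "S \<inter> A" ?F u]
      set_integrable_cong[of lborel lborel "S - A" "S - A" ?F w] by simp_all
  then have "set_integrable lborel (S \<inter> A \<union> (S - A)) ?F"
    by (rule set_integrable_Un) auto
  then show ?thesis by (simp add: Int_Diff_Un)
qed

text \<open>The integrand may jump across the curve, so the iterated integral is obtained through
  the Lebesgue integral, where integrability on the rectangle permits Fubini.\<close>

lemma integral_Times_Fubini:
  fixes F :: "real \<times> real \<Rightarrow> real"
  assumes F: "set_integrable lborel ({a..b} \<times> {c..d}) F" and K: "continuous_on {a..b} K"
    and int: "\<And>x. x \<in> {a..b} \<Longrightarrow> set_integrable lborel {c..d} (\<lambda>y. F (x, y))"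
    and eq: "\<And>x. x \<in> {a..b} \<Longrightarrow> integral {c..d} (\<lambda>y. F (x, y)) = K x"
  shows "integral ({a..b} \<times> {c..d}) F = integral {a..b} K"
proof -
  have "integral ({a..b} \<times> {c..d}) F
      = (\<integral>p. indicator ({a..b} \<times> {c..d}) p *\<^sub>R F p \<partial>(lborel \<Otimes>\<^sub>M lborel))"
    using set_borel_integral_eq_integral(2)[OF F] by (simp add: set_lebesgue_integral_def lborel_prod)
  also have "\<dots> = (\<integral>x. (\<integral>y. indicator ({a..b} \<times> {c..d}) (x, y) *\<^sub>R F (x, y) \<partial>lborel) \<partial>lborel)"
    using F by (intro lborel_pair.integral_fst'[symmetric]) (simp add: set_integrable_def lborel_prod)
  also have "\<dots> = (LINT x : {a..b} | lborel. K x)"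
    unfolding set_lebesgue_integral_def
  proof (rule Bochner_Integration.integral_cong[OF refl])
    fix x :: real
    show "(\<integral>y. indicator ({a..b} \<times> {c..d}) (x, y) *\<^sub>R F (x, y) \<partial>lborel) = indicator {a..b} x *\<^sub>R K x"
    proof (cases "x \<in> {a..b}")
      case True
      then have "(\<integral>y. indicator ({a..b} \<times> {c..d}) (x, y) *\<^sub>R F (x, y) \<partial>lborel)
          = (LINT y : {c..d} | lborel. F (x, y))"
        by (simp add: set_lebesgue_integral_def indicator_times)
      also have "\<dots> = K x" using set_borel_integral_eq_integral(2)[OF int[OF True]] eq[OF True] by simp
      finally show ?thesis using True by simp
    qed (simp add: indicator_times)
  qed
  also have "\<dots> = integral {a..b} K"
    by (intro set_borel_integral_eq_integral) (unfold set_integrable_def, rule borel_integrable_compact, auto simp: K)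
  finally show ?thesis .
qed

text \<open>The data function is arbitrary on the curve, so pointwise bounds are available only off
  a null set; the difference is replaced by zero there.\<close>

lemma integral_diff_bound_off_negligible:
  fixes f u :: "'a::euclidean_space \<Rightarrow> real"
  assumes "f integrable_on cbox a b" "u integrable_on cbox a b" "negligible \<Gamma>" "0 \<le> e"
    and e: "\<And>p. p \<in> cbox a b - \<Gamma> \<Longrightarrow> \<bar>f p - u p\<bar> \<le> e"
  shows "\<bar>integral (cbox a b) f - integral (cbox a b) u\<bar> \<le> e * measure lborel (cbox a b)"
proof -
  have "((\<lambda>p. f p - u p) has_integral (integral (cbox a b) f - integral (cbox a b) u)) (cbox a b)"
    using assms by (intro has_integral_diff integrable_integral)
  then have "((\<lambda>p. if p \<in> \<Gamma> then 0 else f p - u p) has_integral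
      (integral (cbox a b) f - integral (cbox a b) u)) (cbox a b)"
    by (rule has_integral_spike[OF \<open>negligible \<Gamma>\<close>, rotated]) simp
  from has_integral_bound[OF \<open>0 \<le> e\<close> this] show ?thesis using e \<open>0 \<le> e\<close> by simp
qed

lemma negligible_graph:
  fixes g :: "real \<Rightarrow> real"
  assumes "g differentiable_on S"
  shows "negligible ((\<lambda>x. (x, g x)) ` S)"
  by (rule negligible_differentiable_image_lowdim)
    (use assms in \<open>auto intro!: derivative_intros simp: differentiable_on_def\<close>)

lemma integral_Times_split:
  fixes f :: "real \<times> real \<Rightarrow> real"
  assumes f: "f integrable_on ({a..b} \<times> {c..e})" and "c \<le> d" "d \<le> e"
  shows "integral ({a..b} \<times> {c..e}) f = integral ({a..b} \<times> {c..d}) f + integral ({a..b} \<times> {d..e}) f"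
proof -
  have "f integrable_on cbox (a, c) (b, d)" "f integrable_on cbox (a, d) (b, e)"
    by (rule integrable_on_subcbox[OF f]; use assms in \<open>auto simp: cbox_Pair_eq\<close>)+
  moreover have "negligible (({a..b} \<times> {c..d}) \<inter> ({a..b} \<times> {d..e}))"
  proof (rule negligible_subset)
    show "negligible (cbox (a, d) (b, d))" by (auto simp: negligible_interval box_eq_empty Basis_prod_def)
    show "({a..b} \<times> {c..d}) \<inter> ({a..b} \<times> {d..e}) \<subseteq> cbox (a, d) (b, d)" by (auto simp: cbox_Pair_eq)
  qed
  moreover have "{a..b} \<times> {c..e} = {a..b} \<times> {c..d} \<union> {a..b} \<times> {d..e}" using assms by auto
  ultimately show ?thesis by (simp add: cbox_Pair_eq integral_Un)
qed

section \<open>Consequences of the local setting and comparison of cell averages\<close>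

lemma Ck_norm_le2_imp_continuous_on:
  assumes "Ck_norm_le2 k S f M"
  shows "continuous_on S f"
proof -
  obtain D where "D 0 0 = f" "\<And>i j. i + j \<le> k \<Longrightarrow> continuous_on S (D i j)"
    using assms unfolding Ck_norm_le2_def by blast
  from this(2)[of 0 0] this(1) show ?thesis by simp
qed

lemma Ck_norm_le2_imp_bounded:
  assumes "Ck_norm_le2 k S f M" "p \<in> S"
  shows "\<bar>f p\<bar> \<le> M"
proof -
  obtain D where "D 0 0 = f" "\<And>i j. i + j \<le> k \<Longrightarrow> \<forall>p\<in>S. \<bar>D i j p\<bar> \<le> M"
    using assms(1) unfolding Ck_norm_le2_def by blast
  from this(2)[of 0 0] this(1) assms(2) show ?thesis by simp
qed

lemma local_settingD:
  assumes "local_setting M \<delta> h g f1 f2 f" "0 < h"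
  shows "continuous_on {h..4*h} g" "negligible ((\<lambda>x. (x, g x)) ` {h..4*h})"
    and "x \<in> {h..4*h} \<Longrightarrow> 3*h \<le> g x" "x \<in> {h..4*h} \<Longrightarrow> g x \<le> 7*h"
    and "continuous_on {(x, y) \<in> window h. y \<le> g x} f1" "continuous_on {(x, y) \<in> window h. g x \<le> y} f2"
    and "compact {(x, y) \<in> window h. y \<le> g x}" "compact {(x, y) \<in> window h. g x \<le> y}"
    and "(x, y) \<in> window h \<Longrightarrow> y < g x \<Longrightarrow> f (x, y) = f1 (x, y)"
    and "(x, y) \<in> window h \<Longrightarrow> g x < y \<Longrightarrow> f (x, y) = f2 (x, y)"
    and "x \<in> {h..4*h} \<Longrightarrow> \<delta> \<le> \<bar>f1 (x, g x) - f2 (x, g x)\<bar>"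
    and "0 \<le> M"
proof -
  have g: "Ck_norm_le1 3 {h..4*h} g M" using assms by (simp add: local_setting_def)
  then obtain D where D: "D 0 = g" "\<And>x. x \<in> {h..4*h} \<Longrightarrow> (D 0 has_real_derivative D (Suc 0) x) (at x within {h..4*h})"
    and M: "\<And>x. x \<in> {h..4*h} \<Longrightarrow> \<bar>D 0 x\<bar> \<le> M"
    unfolding Ck_norm_le1_def by (metis zero_less_numeral le0)
  have diff: "g differentiable_on {h..4*h}"
    using D unfolding differentiable_on_def real_differentiable_def by metis
  then show cont: "continuous_on {h..4*h} g" by (rule differentiable_imp_continuous_on)
  show "negligible ((\<lambda>x. (x, g x)) ` {h..4*h})" by (rule negligible_graph[OF diff])
  show "0 \<le> M" using M[of h] assms(2) by simp
  \<comment> \<open>The signed vertical distance to the graph; the two closed regions are its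
    preimages of half-lines.\<close>
  have c: "continuous_on (window h) (\<lambda>p. snd p - g (fst p))"
    by (rule continuous_on_diff continuous_on_compose2[OF cont] continuous_intros | force simp: window_def)+
  have cw: "compact (window h)" "closed (window h)"
    unfolding window_def by (auto intro!: compact_Times closed_Times)
  have "{(x, y) \<in> window h. y \<le> g x} = window h \<inter> (\<lambda>p. snd p - g (fst p)) -` {..0}"
    "{(x, y) \<in> window h. g x \<le> y} = window h \<inter> (\<lambda>p. snd p - g (fst p)) -` {0..}" by auto
  then have cl: "closed {(x, y) \<in> window h. y \<le> g x}" "closed {(x, y) \<in> window h. g x \<le> y}"
    using continuous_closed_preimage[OF c cw(2)] by auto
  have compact_if_closed: "compact T" if "closed T" "T \<subseteq> window h" for T
    using compact_Int_closed[OF cw(1) that(1)] that(2) by (simp add: Int_absorb1)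
  show "compact {(x, y) \<in> window h. y \<le> g x}" "compact {(x, y) \<in> window h. g x \<le> y}"
    by (rule compact_if_closed; use cl in auto)+
  have "Ck_norm_le2 2 {(x, y) \<in> window h. y \<le> g x} f1 M" "Ck_norm_le2 2 {(x, y) \<in> window h. g x \<le> y} f2 M"
    using assms by (auto simp: local_setting_def)
  then show "continuous_on {(x, y) \<in> window h. y \<le> g x} f1" "continuous_on {(x, y) \<in> window h. g x \<le> y} f2"
    by (auto dest: Ck_norm_le2_imp_continuous_on)
qed (use assms in \<open>auto simp: local_setting_def image_subset_iff\<close>)

text \<open>Off the graph, which is null, \<open>f\<close> agrees with a function glued from
  \<open>f1\<close> and \<open>f2\<close> on compact regions.\<close>

lemma integrable_on_window:
  assumes ls: "local_setting M \<delta> h g f1 f2 f" "0 < h" and "cbox a b \<subseteq> window h"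
  shows "f integrable_on cbox a b"
proof -
  let ?A = "{(x, y) \<in> window h. y \<le> g x}" and ?B = "{(x, y) \<in> window h. g x \<le> y}"
  note l = local_settingD[OF ls]
  have "set_integrable lborel (cbox a b) (\<lambda>p. if p \<in> ?A then f1 p else f2 p)"
    by (rule set_integrable_piecewise[OF l(7,8,5,6)]) (use assms(3) in auto)
  then have "(\<lambda>p. if p \<in> ?A then f1 p else f2 p) integrable_on cbox a b"
    by (rule set_borel_integral_eq_integral)
  then show ?thesis
    by (rule integrable_spike[OF _ l(2)])
      (use assms(3) l(9,10) in \<open>force simp: window_def image_def\<close>)
qed

lemma cell_subset_window:
  assumes "0 \<le> h" "2 \<le> i" "i \<le> 4" "2 \<le> j" "j \<le> 9"
  shows "cell h i j \<subseteq> window h"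
proof -
  have "1 \<le> real i - 1" "real i \<le> 4" "1 \<le> real j - 1" "real j \<le> 9" using assms by auto
  then have "1 * h \<le> (real i - 1) * h" "real i * h \<le> 4 * h" "1 * h \<le> (real j - 1) * h" "real j * h \<le> 9 * h"
    using \<open>0 \<le> h\<close> by (intro mult_right_mono; simp)+
  then show ?thesis by (auto simp: cell_def window_def)
qed

lemma measure_cell: "0 \<le> h \<Longrightarrow> measure lborel (cell h i j) = h\<^sup>2"
  by (simp add: cell_eq_cbox content_Pair algebra_simps power2_eq_square)

lemma cell_avg_diff_bound:
  assumes "0 < h" "f integrable_on cell h i j" "u integrable_on cell h i j" "negligible \<Gamma>" "0 \<le> e"
    and "\<And>p. p \<in> cell h i j - \<Gamma> \<Longrightarrow> \<bar>f p - u p\<bar> \<le> e"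
  shows "\<bar>cell_avg h f i j - cell_avg h u i j\<bar> \<le> e"
proof -
  have "\<bar>integral (cell h i j) f - integral (cell h i j) u\<bar> \<le> e * h\<^sup>2"
    using assms integral_diff_bound_off_negligible[of f "((real i - 1) * h, (real j - 1) * h)" "(real i * h, real j * h)" u \<Gamma> e]
    by (simp add: measure_cell flip: cell_eq_cbox)
  then show ?thesis using \<open>0 < h\<close>
    by (simp add: cell_avg_def abs_divide pos_divide_le_eq flip: diff_divide_distrib)
qed

section \<open>The linear pieces\<close>

text \<open>\<open>L\<close> reproduces three cell averages of \<open>f\<close>, and on those cells
  the Taylor polynomial of \<open>fk\<close> is within \<open>e = 97 * M * h^2\<close> of
  \<open>f\<close> off the curve. So the affine difference is at most \<open>e\<close> at three cell
  centres in L shape, hence at most \<open>17 * e\<close> on the whole window. Adding the Taylor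
  error gives \<open>18 * e = 1746 * M * h^2\<close>. The set \<open>S\<close> and the function
  \<open>fk\<close> stand for either side of the curve.\<close>

lemma linear_piece_approx:
  assumes ls: "local_setting M \<delta> h g f1 f2 f" and h: "0 < h" "h \<le> 1"
    and L: "linear_piece h f {(3, j'), (3, j), (4, j)} L"
    and j: "(j' = 2 \<and> j = 3) \<or> (j' = 9 \<and> j = 8)"
    and fk: "Ck_norm_le2 2 S fk M" and S: "S \<subseteq> window h"
    and y0: "h \<le> y0" "y0 \<le> 9 * h" and base: "\<And>x. x \<in> {h..4*h} \<Longrightarrow> (x, y0) \<in> S"
    and vert: "\<And>x y t. (x, y) \<in> S \<Longrightarrow> t \<in> closed_segment y0 y \<Longrightarrow> (x, t) \<in> S"
    and off: "\<And>i x y. i \<in> {3, 4} \<Longrightarrow> (x, y) \<in> cell h i j \<union> cell h i j' \<Longrightarrow> y \<noteq> g x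
        \<Longrightarrow> (x, y) \<in> S \<and> f (x, y) = fk (x, y)"
  shows "\<exists>\<alpha> \<beta> \<gamma>. L = (\<lambda>(x, y). \<alpha> * x + \<beta> * y + \<gamma>) \<and> \<bar>\<alpha>\<bar> \<le> 195 * M \<and> \<bar>\<beta>\<bar> \<le> 195 * M \<and>
    (\<forall>(x, y)\<in>S. \<bar>fk (x, y) - (\<alpha> * x + \<beta> * y + \<gamma>)\<bar> \<le> 1746 * M * h\<^sup>2)"
proof -
  note l = local_settingD[OF ls h(1)]
  define e where "e = 97 * M * h\<^sup>2"
  have e0: "0 \<le> e" using l(12) by (simp add: e_def)
  obtain a b c where ab: "\<bar>a\<bar> \<le> M" "\<bar>b\<bar> \<le> M"
    and T: "\<And>x y. (x, y) \<in> S \<Longrightarrow> \<bar>fk (x, y) - (a * x + b * y + c)\<bar> \<le> e"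
    using C2_affine_approx[OF fk S _ y0 base vert] h unfolding e_def by fastforce
  obtain \<alpha> \<beta> \<gamma> where L_eq: "L = (\<lambda>(x, y). \<alpha> * x + \<beta> * y + \<gamma>)"
    and L_avg: "\<And>i k. (i, k) \<in> {(3, j'), (3, j), (4, j)} \<Longrightarrow> cell_avg h L i k = cell_avg h f i k"
    using L unfolding linear_piece_def by blast
  have avg: "\<bar>(\<alpha> - a) * ((real i - 1/2) * h) + (\<beta> - b) * ((real k - 1/2) * h) + (\<gamma> - c)\<bar> \<le> e"
    if ik: "(i, k) \<in> {(3, j'), (3, j), (4, j)}" for i k
  proof -
    have sub: "cell h i k \<subseteq> window h" using ik j h by (intro cell_subset_window) auto
    have "\<bar>cell_avg h f i k - cell_avg h (\<lambda>(x, y). a * x + b * y + c) i k\<bar> \<le> e"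
    proof (rule cell_avg_diff_bound[OF h(1) _ _ l(2) e0])
      show "f integrable_on cell h i k"
        using integrable_on_window[OF ls h(1)] sub unfolding cell_eq_cbox by blast
      show "(\<lambda>(x, y). a * x + b * y + c) integrable_on cell h i k"
        unfolding cell_eq_cbox case_prod_unfold by (intro integrable_continuous continuous_intros)
      fix p assume p: "p \<in> cell h i k - (\<lambda>x. (x, g x)) ` {h..4*h}"
      obtain x y where xy: "p = (x, y)" by (cases p)
      have "x \<in> {h..4*h}" using p sub by (auto simp: xy window_def)
      then have "(x, y) \<in> S \<and> f (x, y) = fk (x, y)" using p ik by (intro off[of i]) (auto simp: xy)
      then show "\<bar>f p - (case p of (x, y) \<Rightarrow> a * x + b * y + c)\<bar> \<le> e" using T by (simp add: xy)
    qed
    then show ?thesis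
      using L_avg[OF ik] unfolding L_eq cell_avg_affine[OF h(1)]
      by (simp add: algebra_simps abs_le_iff diff_divide_distrib)
  qed
  have s: "\<bar>real j' - real j\<bar> = 1" and j_bds: "5/2 \<le> real j - 1/2" "real j - 1/2 \<le> 15/2"
    using j by auto
  have "\<bar>(\<alpha> - a) * (5/2 * h) + (\<beta> - b) * ((real j - 1/2 + (real j' - real j)) * h) + (\<gamma> - c)\<bar> \<le> e"
    "\<bar>(\<alpha> - a) * (5/2 * h) + (\<beta> - b) * ((real j - 1/2) * h) + (\<gamma> - c)\<bar> \<le> e"
    "\<bar>(\<alpha> - a) * (7/2 * h) + (\<beta> - b) * ((real j - 1/2) * h) + (\<gamma> - c)\<bar> \<le> e"
    using avg[of 3 j'] avg[of 3 j] avg[of 4 j] by simp_all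
  note D = affine_bound_from_L_shape[OF h(1) s this j_bds]
  \<comment> \<open>Dividing \<open>2 * e = 194 * M * h^2\<close> by \<open>h\<close> leaves a
    factor \<open>h \<le> 1\<close>; the slope of the Taylor polynomial adds one more
    \<open>M\<close>.\<close>
  have slope: "\<bar>s\<bar> \<le> 195 * M" if "\<bar>s - t\<bar> * h \<le> 2 * e" "\<bar>t\<bar> \<le> M" for s t
  proof -
    have "\<bar>s - t\<bar> * h \<le> (194 * M * h) * h" using that by (simp add: e_def power2_eq_square)
    then have "\<bar>s - t\<bar> \<le> 194 * M * h" using h(1) by simp
    also have "\<dots> \<le> 194 * M" using l(12) h by (simp add: mult_left_le)
    finally show ?thesis using that(2) by linarith
  qed
  have "\<bar>fk (x, y) - (\<alpha> * x + \<beta> * y + \<gamma>)\<bar> \<le> 1746 * M * h\<^sup>2" if "(x, y) \<in> S" for x y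
  proof -
    have "\<bar>(\<alpha> - a) * x + (\<beta> - b) * y + (\<gamma> - c)\<bar> \<le> 17 * e" using D(3) that S by blast
    with T[OF that] have "\<bar>fk (x, y) - (\<alpha> * x + \<beta> * y + \<gamma>)\<bar> \<le> 18 * e"
      by (simp add: algebra_simps abs_le_iff)
    then show ?thesis by (simp add: e_def)
  qed
  with L_eq slope[OF D(1) ab(1)] slope[OF D(2) ab(2)] show ?thesis by blast
qed

text \<open>The base line is \<open>y = 3 * h\<close>: the graph never goes below it, vertical
  segments from it to points under the graph stay under the graph, and the three cells lie on or
  below it.\<close>

lemma lower_piece_approx:
  assumes ls: "local_setting M \<delta> h g f1 f2 f" and h: "0 < h" "h \<le> 1"
    and L: "linear_piece h f {(3, 2), (3, 3), (4, 3)} L"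
  shows "\<exists>\<alpha> \<beta> \<gamma>. L = (\<lambda>(x, y). \<alpha> * x + \<beta> * y + \<gamma>) \<and> \<bar>\<alpha>\<bar> \<le> 195 * M \<and> \<bar>\<beta>\<bar> \<le> 195 * M \<and>
    (\<forall>(x, y)\<in>{(x, y) \<in> window h. y \<le> g x}. \<bar>f1 (x, y) - (\<alpha> * x + \<beta> * y + \<gamma>)\<bar> \<le> 1746 * M * h\<^sup>2)"
proof (rule linear_piece_approx[where ?y0.0 = "3 * h", OF ls h L])
  note l = local_settingD[OF ls h(1)]
  show "Ck_norm_le2 2 {(x, y) \<in> window h. y \<le> g x} f1 M" using ls by (simp add: local_setting_def)
  show "(x, 3 * h) \<in> {(x, y) \<in> window h. y \<le> g x}" if "x \<in> {h..4 * h}" for x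
    using that l(3)[OF that] h by (simp add: window_def)
  show "(x, t) \<in> {(x, y) \<in> window h. y \<le> g x}"
    if "(x, y) \<in> {(x, y) \<in> window h. y \<le> g x}" "t \<in> closed_segment (3 * h) y" for x y t
    using that l(3)[of x] h by (auto simp: window_def closed_segment_eq_real_ivl split: if_splits)
  show "(x, y) \<in> {(x, y) \<in> window h. y \<le> g x} \<and> f (x, y) = f1 (x, y)"
    if i: "i \<in> {3, 4}" and xy: "(x, y) \<in> cell h i 3 \<union> cell h i 2" and "y \<noteq> g x" for i x y
  proof -
    have w: "(x, y) \<in> window h" using xy cell_subset_window[of h i 3] cell_subset_window[of h i 2] i h by auto
    then have "3 * h \<le> g x" by (intro l) (simp add: window_def)
    moreover have "y \<le> 3 * h" using xy h by (auto simp: cell_def)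
    ultimately show ?thesis using w l(9) \<open>y \<noteq> g x\<close> by simp
  qed
qed (use h in auto)

text \<open>Mirror image with base line \<open>y = 7 * h\<close>, which the graph never
  exceeds.\<close>

lemma upper_piece_approx:
  assumes ls: "local_setting M \<delta> h g f1 f2 f" and h: "0 < h" "h \<le> 1"
    and L: "linear_piece h f {(3, 9), (3, 8), (4, 8)} L"
  shows "\<exists>\<alpha> \<beta> \<gamma>. L = (\<lambda>(x, y). \<alpha> * x + \<beta> * y + \<gamma>) \<and> \<bar>\<alpha>\<bar> \<le> 195 * M \<and> \<bar>\<beta>\<bar> \<le> 195 * M \<and>
    (\<forall>(x, y)\<in>{(x, y) \<in> window h. g x \<le> y}. \<bar>f2 (x, y) - (\<alpha> * x + \<beta> * y + \<gamma>)\<bar> \<le> 1746 * M * h\<^sup>2)"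
proof (rule linear_piece_approx[where ?y0.0 = "7 * h", OF ls h L])
  note l = local_settingD[OF ls h(1)]
  show "Ck_norm_le2 2 {(x, y) \<in> window h. g x \<le> y} f2 M" using ls by (simp add: local_setting_def)
  show "(x, 7 * h) \<in> {(x, y) \<in> window h. g x \<le> y}" if "x \<in> {h..4 * h}" for x
    using that l(4)[OF that] h by (simp add: window_def)
  show "(x, t) \<in> {(x, y) \<in> window h. g x \<le> y}"
    if "(x, y) \<in> {(x, y) \<in> window h. g x \<le> y}" "t \<in> closed_segment (7 * h) y" for x y t
    using that l(4)[of x] h by (auto simp: window_def closed_segment_eq_real_ivl split: if_splits)
  show "(x, y) \<in> {(x, y) \<in> window h. g x \<le> y} \<and> f (x, y) = f2 (x, y)"
    if i: "i \<in> {3, 4}" and xy: "(x, y) \<in> cell h i 8 \<union> cell h i 9" and "y \<noteq> g x" for i x y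
  proof -
    have w: "(x, y) \<in> window h" using xy cell_subset_window[of h i 8] cell_subset_window[of h i 9] i h by auto
    then have "g x \<le> 7 * h" by (intro l) (simp add: window_def)
    moreover have "7 * h \<le> y" using xy h by (auto simp: cell_def)
    ultimately show ?thesis using w l(10) \<open>y \<noteq> g x\<close> by simp
  qed
qed (use h in auto)

section \<open>The mapping Q\<close>

definition affine_prim :: "real \<Rightarrow> real \<Rightarrow> real \<Rightarrow> real \<Rightarrow> real \<Rightarrow> real" where
  "affine_prim \<alpha> \<beta> \<gamma> x y = (\<alpha> * x + \<gamma>) * y + \<beta> * y\<^sup>2 / 2"

lemma affine_prim_deriv:
  "((\<lambda>y. affine_prim \<alpha> \<beta> \<gamma> x y) has_vector_derivative (\<alpha> * x + \<beta> * y + \<gamma>)) (at y within S)"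
  unfolding affine_prim_def
  by (auto intro!: derivative_eq_intros simp flip: has_real_derivative_iff_has_vector_derivative)

lemma continuous_on_affine_prim [continuous_intros]:
  "continuous_on S u \<Longrightarrow> continuous_on S w \<Longrightarrow> continuous_on S (\<lambda>x. affine_prim \<alpha> \<beta> \<gamma> (u x) (w x))"
  unfolding affine_prim_def by (intro continuous_intros) auto

text \<open>For \<open>3 * h \<le> y \<le> 7 * h\<close>: the integral over the segment \<open>{x} \<times> {3*h..7*h}\<close> of the function that equals
  the first affine function below \<open>y\<close> and the second one above \<open>y\<close>.\<close>

definition column_mass :: "real \<Rightarrow> real \<Rightarrow> real \<Rightarrow> real \<Rightarrow> real \<Rightarrow> real \<Rightarrow> real \<Rightarrow> real \<Rightarrow> real \<Rightarrow> real" where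
  "column_mass h a1 b1 c1 a2 b2 c2 x y = affine_prim a1 b1 c1 x y - affine_prim a1 b1 c1 x (3*h)
      + affine_prim a2 b2 c2 x (7*h) - affine_prim a2 b2 c2 x y"

text \<open>\<open>f\<close> is replaced on the column by \<open>F\<close>, the two affine functions
  separated by the true curve. The pointwise error is at most \<open>e\<close> off the curve and the
  column has area \<open>4 * h^2\<close>, whence \<open>4 * e\<close>. Fubini turns the integral of
  \<open>F\<close> into that of \<open>column_mass\<close> at height \<open>g x\<close>.\<close>

lemma column_avg_approx:
  assumes ls: "local_setting M \<delta> h g f1 f2 f" and h: "0 < h" and i: "2 \<le> i" "i \<le> 4" and e: "0 \<le> e"
    and 1: "\<And>x y. (x, y) \<in> window h \<Longrightarrow> y \<le> g x \<Longrightarrow> \<bar>f1 (x, y) - (a1 * x + b1 * y + c1)\<bar> \<le> e"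
    and 2: "\<And>x y. (x, y) \<in> window h \<Longrightarrow> g x \<le> y \<Longrightarrow> \<bar>f2 (x, y) - (a2 * x + b2 * y + c2)\<bar> \<le> e"
  shows "\<bar>col_data h f i - integral {(real i - 1) * h..real i * h} (\<lambda>x. column_mass h a1 b1 c1 a2 b2 c2 x (g x)) / h\<^sup>2\<bar> \<le> 4 * e"
proof -
  note l = local_settingD[OF ls h]
  define X where "X = {(real i - 1) * h..real i * h}"
  define A where "A = {(x, y) \<in> window h. y \<le> g x}"
  define B where "B = {(x, y) \<in> window h. g x \<le> y}"
  define F where "F = (\<lambda>p. if p \<in> A then a1 * fst p + b1 * snd p + c1 else a2 * fst p + b2 * snd p + c2)"
  have X: "X \<subseteq> {h..4*h}"
  proof
    fix x assume "x \<in> X"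
    \<comment> \<open>An auxiliary height: inclusion of one cell of the column in the window yields
      the inclusion of the first coordinates.\<close>
    then have "(x, 2*h) \<in> cell h i 2" using h by (simp add: X_def cell_def)
    moreover have "cell h i 2 \<subseteq> window h" using h i by (intro cell_subset_window) auto
    ultimately show "x \<in> {h..4*h}" by (auto simp: window_def)
  qed
  have XW: "X \<times> {3*h..7*h} \<subseteq> window h" using X h by (auto simp: window_def)
  have box: "X \<times> {3*h..7*h} = cbox ((real i - 1) * h, 3*h) (real i * h, 7*h)" by (simp add: X_def cbox_Pair_eq)
  have F: "set_integrable lborel (X \<times> {3*h..7*h}) F"
    unfolding F_def
  proof (rule set_integrable_piecewise)
    show "compact A" "compact B" using l by (auto simp: A_def B_def)
    show "X \<times> {3*h..7*h} \<in> sets borel" unfolding box by simp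
    show "X \<times> {3*h..7*h} \<subseteq> A \<union> B" using XW by (auto simp: A_def B_def)
  qed (intro continuous_intros)+
  have "integral (X \<times> {3*h..7*h}) F = integral X (\<lambda>x. column_mass h a1 b1 c1 a2 b2 c2 x (g x))"
    unfolding X_def
  proof (rule integral_Times_Fubini)
    show "set_integrable lborel ({(real i - 1) * h..real i * h} \<times> {3*h..7*h}) F" using F by (simp add: X_def)
    show "continuous_on {(real i - 1) * h..real i * h} (\<lambda>x. column_mass h a1 b1 c1 a2 b2 c2 x (g x))"
      using continuous_on_subset[OF l(1) X] unfolding column_mass_def X_def by (intro continuous_intros)
    fix x assume "x \<in> {(real i - 1) * h..real i * h}"
    then have x: "x \<in> X" by (simp add: X_def)
    then have g: "3*h \<le> g x" "g x \<le> 7*h" using l(3,4) X by auto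
    have A_iff: "(x, y) \<in> A \<longleftrightarrow> y \<in> {3*h..g x}" if "y \<in> {3*h..7*h}" for y
      using XW x that by (auto simp: A_def)
    have "set_integrable lborel {3*h..7*h} (\<lambda>y. if y \<in> {3*h..g x} then a1 * x + b1 * y + c1 else a2 * x + b2 * y + c2)"
      by (rule set_integrable_piecewise[where B = "{g x..7*h}"]) (auto intro!: continuous_intros)
    then show "set_integrable lborel {3*h..7*h} (\<lambda>y. F (x, y))"
      using set_integrable_cong[of lborel lborel "{3*h..7*h}" "{3*h..7*h}" "\<lambda>y. F (x, y)"
          "\<lambda>y. if y \<in> {3*h..g x} then a1 * x + b1 * y + c1 else a2 * x + b2 * y + c2"] A_iff
      by (simp add: F_def)
    have "((\<lambda>y. F (x, y)) has_integral (affine_prim a1 b1 c1 x (g x) - affine_prim a1 b1 c1 x (3*h))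
        + (affine_prim a2 b2 c2 x (7*h) - affine_prim a2 b2 c2 x (g x))) {3*h..7*h}"
    proof (rule has_integral_combine[OF g])
      have "((\<lambda>y. a1 * x + b1 * y + c1) has_integral affine_prim a1 b1 c1 x (g x) - affine_prim a1 b1 c1 x (3*h)) {3*h..g x}"
        by (rule fundamental_theorem_of_calculus[OF g(1) affine_prim_deriv])
      then show "((\<lambda>y. F (x, y)) has_integral affine_prim a1 b1 c1 x (g x) - affine_prim a1 b1 c1 x (3*h)) {3*h..g x}"
        by (rule has_integral_eq[rotated]) (use A_iff g in \<open>auto simp: F_def\<close>)
      have "((\<lambda>y. a2 * x + b2 * y + c2) has_integral affine_prim a2 b2 c2 x (7*h) - affine_prim a2 b2 c2 x (g x)) {g x..7*h}"
        by (rule fundamental_theorem_of_calculus[OF g(2) affine_prim_deriv])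
      \<comment> \<open>\<open>A\<close> contains the graph, so at the single point
        \<open>y = g x\<close> the function \<open>F\<close> takes its value from the first affine
        function.\<close>
      then show "((\<lambda>y. F (x, y)) has_integral affine_prim a2 b2 c2 x (7*h) - affine_prim a2 b2 c2 x (g x)) {g x..7*h}"
        by (rule has_integral_spike_finite[of "{g x}", rotated 2]) (use A_iff g in \<open>auto simp: F_def\<close>)
    qed
    then show "integral {3*h..7*h} (\<lambda>y. F (x, y)) = column_mass h a1 b1 c1 a2 b2 c2 x (g x)"
      by (simp add: integral_unique column_mass_def)
  qed
  moreover have f_int: "f integrable_on (X \<times> {3*h..7*h})"
    using integrable_on_window[OF ls h] XW unfolding box by blast
  have "\<bar>integral (X \<times> {3*h..7*h}) f - integral (X \<times> {3*h..7*h}) F\<bar> \<le> e * measure lborel (X \<times> {3*h..7*h})"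
    unfolding box
  proof (rule integral_diff_bound_off_negligible[OF _ _ l(2) e])
    show "f integrable_on cbox ((real i - 1) * h, 3 * h) (real i * h, 7 * h)" using f_int box by simp
    show "F integrable_on cbox ((real i - 1) * h, 3 * h) (real i * h, 7 * h)"
      using set_borel_integral_eq_integral(1)[OF F] box by simp
    fix p assume p: "p \<in> cbox ((real i - 1) * h, 3 * h) (real i * h, 7 * h) - (\<lambda>x. (x, g x)) ` {h..4 * h}"
    obtain x y where xy: "p = (x, y)" by (cases p)
    have w: "(x, y) \<in> window h" and "x \<in> X" using p XW unfolding box[symmetric] xy by auto
    then have "y \<noteq> g x" using p X by (auto simp: xy)
    then show "\<bar>f p - F p\<bar> \<le> e"
      using 1[OF w] 2[OF w] l(9,10)[OF w] w by (cases "y < g x") (auto simp: F_def A_def xy)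
  qed
  moreover have "measure lborel (X \<times> {3*h..7*h}) = 4 * h\<^sup>2"
    unfolding box using h by (simp add: content_Pair algebra_simps power2_eq_square)
  moreover have "col_data h f i = integral (X \<times> {3*h..7*h}) f / h\<^sup>2"
  proof -
    have sub: "f integrable_on (X \<times> {c..d})" if "3*h \<le> c" "d \<le> 7*h" for c d
    proof -
      have "f integrable_on cbox ((real i - 1) * h, c) (real i * h, d)"
        by (rule integrable_on_subcbox[OF f_int]) (use that in \<open>auto simp: X_def cbox_Pair_eq\<close>)
      then show ?thesis by (simp add: X_def cbox_Pair_eq)
    qed
    have "integral (X \<times> {3*h..7*h}) f = integral (X \<times> {3*h..4*h}) f + integral (X \<times> {4*h..7*h}) f"
      "integral (X \<times> {4*h..7*h}) f = integral (X \<times> {4*h..5*h}) f + integral (X \<times> {5*h..7*h}) f"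
      "integral (X \<times> {5*h..7*h}) f = integral (X \<times> {5*h..6*h}) f + integral (X \<times> {6*h..7*h}) f"
      using h sub unfolding X_def by (intro integral_Times_split; simp)+
    then show ?thesis by (simp add: col_data_def cell_avg_def cell_def X_def add_divide_distrib)
  qed
  ultimately have "\<bar>col_data h f i * h\<^sup>2 - integral X (\<lambda>x. column_mass h a1 b1 c1 a2 b2 c2 x (g x))\<bar> \<le> e * (4 * h\<^sup>2)"
    using h by simp
  moreover have "col_data h f i - integral X (\<lambda>x. column_mass h a1 b1 c1 a2 b2 c2 x (g x)) / h\<^sup>2
      = (col_data h f i * h\<^sup>2 - integral X (\<lambda>x. column_mass h a1 b1 c1 a2 b2 c2 x (g x))) / h\<^sup>2"
    using h by (simp add: field_simps)
  ultimately show ?thesis using h unfolding X_def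
    by (simp add: abs_divide pos_divide_le_eq)
qed

lemma LBINT_eq_integral:
  fixes F :: "real \<Rightarrow> real"
  assumes "a \<le> b" "continuous_on {a..b} F"
  shows "(LBINT x=a..b. F x) = integral {a..b} F"
  by (rule interval_integral_eq_integral[OF assms(1)])
    (unfold set_integrable_def, rule borel_integrable_compact, use assms in auto)

text \<open>The primitive of \<open>L2\<close> up to height \<open>quad h v x\<close> cancels
  between the two integrals, leaving its part above the parabola. The fundamental theorem for
  oriented integrals holds for either order of the endpoints, so the formula persists when the
  parabola leaves \<open>{3*h..7*h}\<close>. \<open>Q\<close> and the data thus become values of one
  functional, at the parabola and at the curve.\<close>

lemma Q_comp_affine:
  assumes h: "0 < h" and L1: "L1 = (\<lambda>(x, y). a1 * x + b1 * y + c1)" and L2: "L2 = (\<lambda>(x, y). a2 * x + b2 * y + c2)"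
  shows "Q_comp h L1 L2 i v = integral {(real i - 1) * h..real i * h} (\<lambda>x. column_mass h a1 b1 c1 a2 b2 c2 x (quad h v x)) / h\<^sup>2"
proof -
  have FTC: "(LBINT y=s..t. \<alpha> * x + \<beta> * y + \<gamma>) = affine_prim \<alpha> \<beta> \<gamma> x t - affine_prim \<alpha> \<beta> \<gamma> x s"
    for s t x \<alpha> \<beta> \<gamma> :: real
    by (rule interval_integral_FTC_finite) (auto intro!: continuous_intros affine_prim_deriv)
  define D where "D x y = affine_prim a1 b1 c1 x y - affine_prim a2 b2 c2 x y" for x y
  have D: "affine_prim (a1 - a2) (b1 - b2) (c1 - c2) = D"
    by (rule ext)+ (simp add: D_def affine_prim_def algebra_simps diff_divide_distrib)
  have in1: "(LBINT y=3*h..quad h v x. L1 (x, y) - L2 (x, y)) = D x (quad h v x) - D x (3*h)" for x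
    using FTC[of "3*h" "quad h v x" "a1 - a2" x "b1 - b2" "c1 - c2"] unfolding D
    by (simp add: L1 L2 algebra_simps)
  have in2: "(LBINT y=3*h..7*h. L2 (x, y)) = affine_prim a2 b2 c2 x (7*h) - affine_prim a2 b2 c2 x (3*h)" for x
    using FTC[of "3*h" "7*h" a2 x b2 c2] by (simp add: L2)
  have le: "(real i - 1) * h \<le> real i * h" using h by simp
  have cont: "continuous_on S (\<lambda>x. D x (quad h v x) - D x (3*h))"
    "continuous_on S (\<lambda>x. affine_prim a2 b2 c2 x (7*h) - affine_prim a2 b2 c2 x (3*h))" for S
    unfolding D_def quad_def by (intro continuous_intros)+
  show ?thesis
    unfolding Q_comp_def in1 in2 LBINT_eq_integral[OF le cont(1)] LBINT_eq_integral[OF le cont(2)]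
      Henstock_Kurzweil_Integration.integral_add[symmetric, OF integrable_continuous_real[OF cont(1)]
        integrable_continuous_real[OF cont(2)]]
    by (simp add: column_mass_def D_def algebra_simps)
qed

section \<open>Quadratics and the weighted coefficient norm\<close>

lemma quad_add: "quad h (v + w) x = quad h v x + quad h w x"
  and quad_diff: "quad h (v - w) x = quad h v x - quad h w x"
  and quad_scaleR: "quad h (r *\<^sub>R v) x = r * quad h v x"
  by (simp_all add: quad_def algebra_simps)

lemma continuous_on_quad [continuous_intros]:
  "continuous_on S u \<Longrightarrow> continuous_on S (\<lambda>x. quad h v (u x))"
  unfolding quad_def by (intro continuous_intros)

text \<open>The weight of the leading coefficient makes this norm comparable with the supremum of \<open>quad h w / h\<close>
  on the window, uniformly in \<open>h\<close>.\<close>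

definition coeff_norm :: "real \<Rightarrow> real^3 \<Rightarrow> real" where
  "coeff_norm h w = h * \<bar>w$1\<bar> + \<bar>w$2\<bar> + \<bar>w$3\<bar>"

lemma abs_quad_le:
  assumes "0 \<le> x" "x \<le> 4 * h"
  shows "\<bar>quad h w x\<bar> \<le> 16 * h * coeff_norm h w"
proof -
  have h: "0 \<le> h" using assms by simp
  have "x\<^sup>2 \<le> (4 * h)\<^sup>2" using assms by (intro power_mono)
  then have "\<bar>w$1 * x\<^sup>2\<bar> \<le> \<bar>w$1\<bar> * (4 * h)\<^sup>2" unfolding abs_mult by (intro mult_left_mono) auto
  moreover have "\<bar>w$2 * x\<bar> \<le> \<bar>w$2\<bar> * (4 * h)" unfolding abs_mult using assms by (intro mult_left_mono) auto
  moreover have "\<bar>w$3 * h\<bar> \<le> \<bar>w$3\<bar> * h" using h by (simp add: abs_mult)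
  ultimately have "\<bar>quad h w x\<bar> \<le> \<bar>w$1\<bar> * (4 * h)\<^sup>2 + \<bar>w$2\<bar> * (4 * h) + \<bar>w$3\<bar> * h"
    unfolding quad_def by linarith
  also have "\<dots> \<le> 16 * h * coeff_norm h w"
    using mult_nonneg_nonneg[OF h abs_ge_zero[of "w$2"]] mult_nonneg_nonneg[OF h abs_ge_zero[of "w$3"]]
    by (simp add: coeff_norm_def power2_eq_square algebra_simps)
  finally show ?thesis .
qed

lemma integral_quad:
  assumes "a \<le> b"
  shows "integral {a..b} (quad h w) = w$1 * (b^3 - a^3) / 3 + w$2 * (b\<^sup>2 - a\<^sup>2) / 2 + w$3 * h * (b - a)"
proof -
  have "(quad h w has_integral (w$1 * b^3 / 3 + w$2 * b\<^sup>2 / 2 + w$3 * h * b)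
      - (w$1 * a^3 / 3 + w$2 * a\<^sup>2 / 2 + w$3 * h * a)) {a..b}"
    unfolding quad_def [abs_def]
    by (rule fundamental_theorem_of_calculus[OF assms])
      (auto intro!: derivative_eq_intros simp flip: has_real_derivative_iff_has_vector_derivative)
  then show ?thesis by (simp add: integral_unique algebra_simps diff_divide_distrib)
qed

lemma coeff_norm_le_moments:
  assumes h: "0 < h"
    and m: "\<And>i. i \<in> {2, 3, 4} \<Longrightarrow> \<bar>integral {(real i - 1) * h..real i * h} (quad h w)\<bar> \<le> m * h\<^sup>2"
  shows "coeff_norm h w \<le> 33 * m"
proof -
  define a where "a = h * w$1"
  have eq: "integral {(real i - 1) * h..real i * h} (quad h w)
      = h\<^sup>2 * (a * ((real i)^3 - (real i - 1)^3) / 3 + w$2 * ((real i)\<^sup>2 - (real i - 1)\<^sup>2) / 2 + w$3)" for i :: nat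
    using h by (subst integral_quad)
      (auto simp: a_def power_mult_distrib power2_eq_square power3_eq_cube algebra_simps diff_divide_distrib)
  have *: "\<bar>a * ((real i)^3 - (real i - 1)^3) / 3 + w$2 * ((real i)\<^sup>2 - (real i - 1)\<^sup>2) / 2 + w$3\<bar> \<le> m"
    if "i \<in> {2, 3, 4}" for i
    using m[OF that] h unfolding eq abs_mult by (simp add: mult.commute)
  have "\<bar>7/3 * a + 3/2 * w$2 + w$3\<bar> \<le> m" "\<bar>19/3 * a + 5/2 * w$2 + w$3\<bar> \<le> m"
    "\<bar>37/3 * a + 7/2 * w$2 + w$3\<bar> \<le> m"
    using *[of 2] *[of 3] *[of 4] by (simp_all add: mult.commute)
  \<comment> \<open>With \<open>a = h * w$1\<close> the three means form a linear system free of
    \<open>h\<close>. Its second difference is \<open>2 * a\<close>, its first difference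
    \<open>4 * a + w$2\<close>, and the first equation then bounds \<open>w$3\<close>; 33 = 2 + 10 +
    21.\<close>
  then have "\<bar>a\<bar> \<le> 2 * m" "\<bar>w$2\<bar> \<le> 10 * m" "\<bar>w$3\<bar> \<le> 21 * m" by linarith+
  moreover have "coeff_norm h w = \<bar>a\<bar> + \<bar>w$2\<bar> + \<bar>w$3\<bar>"
    using h by (simp add: coeff_norm_def a_def abs_mult)
  ultimately show ?thesis by linarith
qed

lemma coeff_norm_triangle: "0 \<le> h \<Longrightarrow> coeff_norm h (v + w) \<le> coeff_norm h v + coeff_norm h w"
  using mult_left_mono[OF abs_triangle_ineq[of "v$1" "w$1"], of h] abs_triangle_ineq[of "v$2" "w$2"]
    abs_triangle_ineq[of "v$3" "w$3"]
  unfolding coeff_norm_def by (simp add: algebra_simps)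

text \<open>The factor \<open>1/h\<close> is harmless: the Newton argument uses this comparison only
  qualitatively, for Euclidean convergence and definiteness.\<close>

lemma norm_le_coeff_norm:
  assumes "0 < h" "h \<le> 1"
  shows "norm w \<le> 1/h * coeff_norm h w"
proof -
  have "norm w \<le> \<bar>w$1\<bar> + \<bar>w$2\<bar> + \<bar>w$3\<bar>" using norm_le_l1_cart[of w] by (simp add: sum_3)
  moreover have "h * (\<bar>w$2\<bar> + \<bar>w$3\<bar>) \<le> \<bar>w$2\<bar> + \<bar>w$3\<bar>" using assms by (intro mult_left_le_one_le) auto
  ultimately have "h * norm w \<le> coeff_norm h w"
    using mult_left_mono[of "norm w" "\<bar>w$1\<bar> + \<bar>w$2\<bar> + \<bar>w$3\<bar>" h] assms
    by (simp add: coeff_norm_def algebra_simps)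
  then show ?thesis using assms by (simp add: field_simps)
qed

lemma coeff_norm_le_norm:
  assumes "0 \<le> h" "h \<le> 1"
  shows "coeff_norm h w \<le> 3 * norm w"
proof -
  have "h * \<bar>w$1\<bar> \<le> \<bar>w$1\<bar>" using assms by (intro mult_left_le_one_le) auto
  then show ?thesis
    using component_le_norm_cart[of w 1] component_le_norm_cart[of w 2] component_le_norm_cart[of w 3]
    by (simp add: coeff_norm_def)
qed

section \<open>The derivative of Q: expansion and bounded inverse\<close>

lemma abs_integral_le_on_column:
  fixes F :: "real \<Rightarrow> real"
  assumes "0 \<le> h" "continuous_on {(r - 1) * h..r * h} F" "\<And>x. x \<in> {(r - 1) * h..r * h} \<Longrightarrow> \<bar>F x\<bar> \<le> b"
  shows "\<bar>integral {(r - 1) * h..r * h} F\<bar> \<le> b * h"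
proof -
  have "norm (integral {(r - 1) * h..r * h} F) \<le> b * (r * h - (r - 1) * h)"
    by (rule integral_bound) (use assms in \<open>auto simp: mult_right_mono\<close>)
  then show ?thesis by (simp add: algebra_simps)
qed

lemma column_subset:
  assumes "0 \<le> h" "i \<in> {2, 3, 4::nat}"
  shows "{(real i - 1) * h..real i * h} \<subseteq> {h..4 * h}"
  using assms by auto

text \<open>Varying the upper limit of the inner integral of \<open>Q_comp\<close> leaves its
  integrand \<open>L1 - L2\<close>, with coefficients \<alpha>, \<beta>, \<gamma>, evaluated on the
  parabola of \<open>v\<close> and multiplied by the variation \<open>quad h w\<close>.\<close>

definition Q_deriv_comp :: "real \<Rightarrow> real \<Rightarrow> real \<Rightarrow> real \<Rightarrow> nat \<Rightarrow> real^3 \<Rightarrow> real^3 \<Rightarrow> real" where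
  "Q_deriv_comp h \<alpha> \<beta> \<gamma> i v w = integral {(real i - 1) * h..real i * h}
     (\<lambda>x. (\<alpha> * x + \<beta> * quad h v x + \<gamma>) * quad h w x) / h\<^sup>2"

definition Q_deriv :: "real \<Rightarrow> real \<Rightarrow> real \<Rightarrow> real \<Rightarrow> real^3 \<Rightarrow> real^3 \<Rightarrow> real^3" where
  "Q_deriv h \<alpha> \<beta> \<gamma> v w = vector [Q_deriv_comp h \<alpha> \<beta> \<gamma> 2 v w, Q_deriv_comp h \<alpha> \<beta> \<gamma> 3 v w, Q_deriv_comp h \<alpha> \<beta> \<gamma> 4 v w]"

lemma linear_Q_deriv: "linear (Q_deriv h \<alpha> \<beta> \<gamma> v)"
proof -
  have int: "(\<lambda>x. (\<alpha> * x + \<beta> * quad h v x + \<gamma>) * quad h w x) integrable_on {(real i - 1) * h..real i * h}" for w i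
    by (intro integrable_continuous_real continuous_intros)
  have "linear (Q_deriv_comp h \<alpha> \<beta> \<gamma> i v)" for i
  proof (rule linearI)
    show "Q_deriv_comp h \<alpha> \<beta> \<gamma> i v (w + z) = Q_deriv_comp h \<alpha> \<beta> \<gamma> i v w + Q_deriv_comp h \<alpha> \<beta> \<gamma> i v z" for w z
      using Henstock_Kurzweil_Integration.integral_add[OF int[of w i] int[of z i]]
      by (simp add: Q_deriv_comp_def quad_add distrib_left add_divide_distrib)
    show "Q_deriv_comp h \<alpha> \<beta> \<gamma> i v (r *\<^sub>R w) = r *\<^sub>R Q_deriv_comp h \<alpha> \<beta> \<gamma> i v w" for r w
      by (simp add: Q_deriv_comp_def quad_scaleR mult.left_commute)
  qed
  note lin = this
  show ?thesis
    by (rule linearI; simp add: Q_deriv_def vec_eq_iff forall_3 vector_3 linear_add[OF lin] linear_scale[OF lin])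
qed

text \<open>\<open>column_mass\<close> is a polynomial of degree at most two in the height, with
  quadratic coefficient \<open>(b1 - b2) / 2\<close>, so its Taylor expansion is exact after the
  second-order term.\<close>

lemma Q_comp_expansion:
  assumes h: "0 < h" and L1: "L1 = (\<lambda>(x, y). a1 * x + b1 * y + c1)" and L2: "L2 = (\<lambda>(x, y). a2 * x + b2 * y + c2)"
  shows "Q_comp h L1 L2 i (v + w) - Q_comp h L1 L2 i v - Q_deriv_comp h (a1 - a2) (b1 - b2) (c1 - c2) i v w
    = integral {(real i - 1) * h..real i * h} (\<lambda>x. (b1 - b2) / 2 * (quad h w x)\<^sup>2) / h\<^sup>2"
proof -
  define X where "X = {(real i - 1) * h..real i * h}"
  define m where "m u x = column_mass h a1 b1 c1 a2 b2 c2 x (quad h u x)" for u x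
  define d where "d x = ((a1 - a2) * x + (b1 - b2) * quad h v x + (c1 - c2)) * quad h w x" for x
  have m: "m u integrable_on X" for u
    unfolding m_def column_mass_def X_def by (intro integrable_continuous_real continuous_intros)
  have d: "d integrable_on X" unfolding d_def X_def by (intro integrable_continuous_real continuous_intros)
  have eq: "m (v + w) x - m v x - d x = (b1 - b2) / 2 * (quad h w x)\<^sup>2" for x
    unfolding m_def d_def column_mass_def affine_prim_def quad_add
    by (simp add: power2_eq_square algebra_simps add_divide_distrib diff_divide_distrib)
  have "integral X (\<lambda>x. (b1 - b2) / 2 * (quad h w x)\<^sup>2) = integral X (\<lambda>x. (m (v + w) x - m v x) - d x)"
    by (simp only: eq)
  also have "\<dots> = (integral X (m (v + w)) - integral X (m v)) - integral X d"
    using m d by (simp add: Henstock_Kurzweil_Integration.integral_diff integrable_diff)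
  finally show ?thesis
    by (simp add: Q_comp_affine[OF h L1 L2] Q_deriv_comp_def X_def m_def[abs_def] d_def[abs_def] diff_divide_distrib)
qed

lemma norm_vector3_le:
  assumes "\<bar>x\<bar> \<le> b" "\<bar>y\<bar> \<le> b" "\<bar>z\<bar> \<le> b"
  shows "norm (vector [x, y, z] :: real^3) \<le> 3 * b"
  using norm_le_l1_cart[of "vector [x, y, z] :: real^3"] assms by (simp add: sum_3 vector_3)

text \<open>The remainder integrates the square of a quantity of size
  \<open>16 * h * coeff_norm h w\<close> over a width \<open>h\<close> and is divided by
  \<open>h^2\<close>: one factor \<open>h\<close> survives, which makes the Newton condition hold
  for small \<open>h\<close>. Here 128 = 16^2 / 2, and the three components give 384.\<close>

lemma Q_expansion_bound:
  assumes h: "0 < h" and L1: "L1 = (\<lambda>(x, y). a1 * x + b1 * y + c1)" and L2: "L2 = (\<lambda>(x, y). a2 * x + b2 * y + c2)"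
    and b: "\<bar>b1 - b2\<bar> \<le> b"
  shows "norm (Q h L1 L2 (v + w) - Q h L1 L2 v - Q_deriv h (a1 - a2) (b1 - b2) (c1 - c2) v w)
    \<le> 384 * b * h * (coeff_norm h w)\<^sup>2"
proof -
  have *: "\<bar>Q_comp h L1 L2 i (v + w) - Q_comp h L1 L2 i v - Q_deriv_comp h (a1 - a2) (b1 - b2) (c1 - c2) i v w\<bar>
      \<le> 128 * b * h * (coeff_norm h w)\<^sup>2" if i: "i \<in> {2, 3, 4}" for i
  proof -
    have "\<bar>integral {(real i - 1) * h..real i * h} (\<lambda>x. (b1 - b2) / 2 * (quad h w x)\<^sup>2)\<bar>
        \<le> (b / 2 * (16 * h * coeff_norm h w)\<^sup>2) * h"
    proof (rule abs_integral_le_on_column)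
      fix x assume "x \<in> {(real i - 1) * h..real i * h}"
      then have "x \<in> {h..4*h}" by (rule subsetD[OF column_subset[OF less_imp_le[OF h] i]])
      then have x: "0 \<le> x" "x \<le> 4 * h" using h by auto
      have "\<bar>quad h w x\<bar>\<^sup>2 \<le> (16 * h * coeff_norm h w)\<^sup>2"
        using abs_quad_le[OF x] by (intro power_mono) auto
      then show "\<bar>(b1 - b2) / 2 * (quad h w x)\<^sup>2\<bar> \<le> b / 2 * (16 * h * coeff_norm h w)\<^sup>2"
        unfolding abs_mult using b by (intro mult_mono) auto
    qed (use h in \<open>auto intro!: continuous_intros\<close>)
    also have "\<dots> = (128 * b * h * (coeff_norm h w)\<^sup>2) * h\<^sup>2" by (simp add: power2_eq_square)
    finally show ?thesis
      unfolding Q_comp_expansion[OF h L1 L2] using h by (simp add: abs_divide pos_divide_le_eq)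
  qed
  have "Q h L1 L2 (v + w) - Q h L1 L2 v - Q_deriv h (a1 - a2) (b1 - b2) (c1 - c2) v w =
    vector [Q_comp h L1 L2 2 (v + w) - Q_comp h L1 L2 2 v - Q_deriv_comp h (a1 - a2) (b1 - b2) (c1 - c2) 2 v w,
      Q_comp h L1 L2 3 (v + w) - Q_comp h L1 L2 3 v - Q_deriv_comp h (a1 - a2) (b1 - b2) (c1 - c2) 3 v w,
      Q_comp h L1 L2 4 (v + w) - Q_comp h L1 L2 4 v - Q_deriv_comp h (a1 - a2) (b1 - b2) (c1 - c2) 4 v w]"
    by (simp add: Q_def Q_deriv_def vec_eq_iff forall_3 vector_3)
  also have "norm \<dots> \<le> 3 * (128 * b * h * (coeff_norm h w)\<^sup>2)"
    by (intro norm_vector3_le *) auto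
  finally show ?thesis by simp
qed

text \<open>Perturbation of a constant weight: with the weight frozen at \<open>d0\<close>, the
  derivative is \<open>d0\<close> times the moments of \<open>quad h w\<close>, which control the
  coefficients. The deviation from \<open>d0\<close> costs a multiple of
  \<open>E * coeff_norm h w\<close> that is absorbed on the left.\<close>

lemma Q_deriv_lower_bound:
  assumes h: "0 < h" and d: "0 < d" "d \<le> \<bar>d0\<bar>" and E: "1056 * E \<le> d"
    and near: "\<And>x. x \<in> {h..4*h} \<Longrightarrow> \<bar>\<alpha> * x + \<beta> * quad h v x + \<gamma> - d0\<bar> \<le> E"
  shows "coeff_norm h w \<le> 66 / d * norm (Q_deriv h \<alpha> \<beta> \<gamma> v w)"
proof -
  define N where "N = coeff_norm h w"
  define r where "r = norm (Q_deriv h \<alpha> \<beta> \<gamma> v w)"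
  have N0: "0 \<le> N" using h by (simp add: N_def coeff_norm_def)
  have "\<bar>integral {(real i - 1) * h..real i * h} (quad h w)\<bar> \<le> ((r + 16 * E * N) / d) * h\<^sup>2"
    if i: "i \<in> {2, 3, 4}" for i
  proof -
    define X where "X = {(real i - 1) * h..real i * h}"
    have 1: "\<bar>Q_deriv_comp h \<alpha> \<beta> \<gamma> i v w\<bar> \<le> r"
      using i component_le_norm_cart[of "Q_deriv h \<alpha> \<beta> \<gamma> v w" 1] component_le_norm_cart[of "Q_deriv h \<alpha> \<beta> \<gamma> v w" 2]
        component_le_norm_cart[of "Q_deriv h \<alpha> \<beta> \<gamma> v w" 3]
      by (auto simp: r_def Q_deriv_def vector_3)
    have 2: "\<bar>integral X (\<lambda>x. (\<alpha> * x + \<beta> * quad h v x + \<gamma> - d0) * quad h w x)\<bar> \<le> (E * (16 * h * N)) * h"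
      unfolding X_def
    proof (rule abs_integral_le_on_column)
      fix x assume "x \<in> {(real i - 1) * h..real i * h}"
      then have x: "x \<in> {h..4*h}" by (intro subsetD[OF column_subset[OF less_imp_le[OF h] i]])
      then have "0 \<le> x" "x \<le> 4 * h" using h by auto
      with near[OF x] show "\<bar>(\<alpha> * x + \<beta> * quad h v x + \<gamma> - d0) * quad h w x\<bar> \<le> E * (16 * h * N)"
        unfolding abs_mult N_def by (intro mult_mono abs_quad_le) auto
    qed (use h in \<open>auto intro!: continuous_intros\<close>)
    have "integral X (\<lambda>x. d0 * quad h w x) = integral X (\<lambda>x. (\<alpha> * x + \<beta> * quad h v x + \<gamma>) * quad h w x
        - (\<alpha> * x + \<beta> * quad h v x + \<gamma> - d0) * quad h w x)"
      by (simp add: algebra_simps)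
    also have "\<dots> = integral X (\<lambda>x. (\<alpha> * x + \<beta> * quad h v x + \<gamma>) * quad h w x)
        - integral X (\<lambda>x. (\<alpha> * x + \<beta> * quad h v x + \<gamma> - d0) * quad h w x)"
      unfolding X_def
      by (intro Henstock_Kurzweil_Integration.integral_diff integrable_continuous_real continuous_intros)
    also have "integral X (\<lambda>x. (\<alpha> * x + \<beta> * quad h v x + \<gamma>) * quad h w x) = Q_deriv_comp h \<alpha> \<beta> \<gamma> i v w * h\<^sup>2"
      using h by (simp add: Q_deriv_comp_def X_def)
    finally have "\<bar>d0 * integral X (quad h w)\<bar> \<le> \<bar>Q_deriv_comp h \<alpha> \<beta> \<gamma> i v w * h\<^sup>2\<bar> + (E * (16 * h * N)) * h"
      using 2 by simp
    also have "\<dots> \<le> r * h\<^sup>2 + (E * (16 * h * N)) * h" using 1 by (simp add: abs_mult mult_right_mono)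
    also have "\<dots> = (r + 16 * E * N) * h\<^sup>2" by (simp add: power2_eq_square algebra_simps)
    finally have "\<bar>d0\<bar> * \<bar>integral X (quad h w)\<bar> \<le> (r + 16 * E * N) * h\<^sup>2" by (simp add: abs_mult)
    moreover have "d * \<bar>integral X (quad h w)\<bar> \<le> \<bar>d0\<bar> * \<bar>integral X (quad h w)\<bar>"
      using d by (intro mult_right_mono) auto
    ultimately have "d * \<bar>integral X (quad h w)\<bar> \<le> (r + 16 * E * N) * h\<^sup>2" by linarith
    then show ?thesis using d by (simp add: X_def field_simps)
  qed
  from coeff_norm_le_moments[OF h this] have "N \<le> 33 * ((r + 16 * E * N) / d)" by (simp add: N_def)
  then have "d * N \<le> 33 * r + 528 * E * N" using d by (simp add: field_simps)
  \<comment> \<open>\<open>528 * E * N\<close> is at most half of \<open>d * N\<close>; absorbing it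
    doubles 33 to 66.\<close>
  moreover have "1056 * E * N \<le> d * N" using E N0 by (intro mult_right_mono)
  ultimately have "d * N \<le> 66 * r" by linarith
  then show ?thesis using d by (simp add: N_def r_def field_simps)
qed

section \<open>Convergence and error estimate\<close>

text \<open>Up to \<open>4 * e\<close> per component, the data are the \<open>column_mass\<close>
  integrals along \<open>g\<close>, while \<open>Q\<close> is the same along the parabola. These
  integrands differ by at most \<open>U * r\<close>; a column of width \<open>h\<close> and division
  by \<open>h^2\<close> give \<open>U * r / h\<close>.\<close>

lemma Q_residual_bound:
  assumes ls: "local_setting M \<delta> h g f1 f2 f" and h: "0 < h"
    and L1: "L1 = (\<lambda>(x, y). a1 * x + b1 * y + c1)" and L2: "L2 = (\<lambda>(x, y). a2 * x + b2 * y + c2)"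
    and 1: "\<And>x y. (x, y) \<in> window h \<Longrightarrow> y \<le> g x \<Longrightarrow> \<bar>f1 (x, y) - (a1 * x + b1 * y + c1)\<bar> \<le> e"
    and 2: "\<And>x y. (x, y) \<in> window h \<Longrightarrow> g x \<le> y \<Longrightarrow> \<bar>f2 (x, y) - (a2 * x + b2 * y + c2)\<bar> \<le> e"
    and e: "0 \<le> e" and g: "\<And>x. x \<in> {h..4*h} \<Longrightarrow> \<bar>g x - quad h v x\<bar> \<le> r"
    and U: "\<And>x. x \<in> {h..4*h} \<Longrightarrow>
      \<bar>(a1 - a2) * x + (b1 - b2) * ((g x + quad h v x) / 2) + (c1 - c2)\<bar> \<le> U"
  shows "norm (Q h L1 L2 v - Fbar h f) \<le> 3 * (4 * e + U * r / h)"
proof -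
  let ?K = "column_mass h a1 b1 c1 a2 b2 c2"
  note l = local_settingD[OF ls h]
  have *: "\<bar>Q_comp h L1 L2 i v - col_data h f i\<bar> \<le> 4 * e + U * r / h" if i: "i \<in> {2, 3, 4}" for i
  proof -
    define X where "X = {(real i - 1) * h..real i * h}"
    have X: "X \<subseteq> {h..4*h}" unfolding X_def using column_subset i h by simp
    have cg: "continuous_on X g" using continuous_on_subset[OF l(1) X] .
    have c: "continuous_on X (\<lambda>x. ?K x (quad h v x))" "continuous_on X (\<lambda>x. ?K x (g x))"
      unfolding column_mass_def by (intro continuous_intros cg)+
    \<comment> \<open>The difference quotient of a quadratic polynomial equals its derivative at the
      midpoint, so the factorization is exact.\<close>
    have K: "?K x (quad h v x) - ?K x (g x)
        = ((a1 - a2) * x + (b1 - b2) * ((g x + quad h v x) / 2) + (c1 - c2)) * (quad h v x - g x)" for x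
      by (simp add: column_mass_def affine_prim_def power2_eq_square field_simps)
    have "\<bar>integral X (\<lambda>x. ?K x (quad h v x) - ?K x (g x))\<bar> \<le> (U * r) * h"
      unfolding X_def
    proof (rule abs_integral_le_on_column)
      show "continuous_on {(real i - 1) * h..real i * h} (\<lambda>x. ?K x (quad h v x) - ?K x (g x))"
        using c by (intro continuous_on_diff) (auto simp: X_def)
      fix x assume "x \<in> {(real i - 1) * h..real i * h}"
      then have x: "x \<in> {h..4*h}" using X by (auto simp: X_def)
      show "\<bar>?K x (quad h v x) - ?K x (g x)\<bar> \<le> U * r"
        unfolding K abs_mult using U[OF x] g[OF x] by (intro mult_mono) (auto simp: abs_minus_commute)
    qed (use h in auto)
    then have "\<bar>(integral X (\<lambda>x. ?K x (quad h v x)) - integral X (\<lambda>x. ?K x (g x))) / h\<^sup>2\<bar> \<le> (U * r) * h / h\<^sup>2"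
      using c integrable_continuous_real h unfolding X_def
      by (subst Henstock_Kurzweil_Integration.integral_diff[symmetric]) (auto simp: abs_divide divide_right_mono)
    moreover have "(U * r) * h / h\<^sup>2 = U * r / h" using h by (simp add: power2_eq_square)
    moreover have "\<bar>col_data h f i - integral X (\<lambda>x. ?K x (g x)) / h\<^sup>2\<bar> \<le> 4 * e"
      unfolding X_def using i by (intro column_avg_approx[OF ls h _ _ e 1 2]) auto
    ultimately show ?thesis
      unfolding Q_comp_affine[OF h L1 L2] X_def[symmetric] diff_divide_distrib by linarith
  qed
  have "Q h L1 L2 v - Fbar h f = vector [Q_comp h L1 L2 2 v - col_data h f 2,
      Q_comp h L1 L2 3 v - col_data h f 3, Q_comp h L1 L2 4 v - col_data h f 4]"
    by (simp add: Q_def Fbar_def vec_eq_iff forall_3 vector_3)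
  also have "norm \<dots> \<le> 3 * (4 * e + U * r / h)" by (intro norm_vector3_le *) auto
  finally show ?thesis .
qed

text \<open>The smallness conditions: \<open>h1\<close> keeps the initial parabola within
  \<open>h\<close> of the curve; \<open>h2\<close> preserves half of the jump and makes
  \<open>L1 - L2\<close> nearly constant, with 28005120 = 2 * 1056 * 13260; \<open>h3\<close> is the
  condition \<open>C * k \<le> 1\<close> of the Newton lemma, with 149760 = 384 * 390;
  \<open>h4\<close> makes the initial scaled residual at most 1/2. Taking \<open>m\<close> and
  \<open>k\<close> at least 1 fixes the signs.\<close>

lemma newton_limit_estimate:
  assumes \<delta>: "0 < \<delta>" and h: "0 < h" "h \<le> 1" and m: "M \<le> m" "1 \<le> m" and k: "K \<le> k" "1 \<le> k"
    and h1: "k * h \<le> 1" and h2: "28005120 * m * h \<le> \<delta>" and h3: "132 / \<delta> * (149760 * m * h) \<le> 1"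
    and h4: "132 / \<delta> * ((20952 + 54000 * k) * m * h) \<le> 1/2"
    and ls: "local_setting M \<delta> h g f1 f2 f"
    and L1: "linear_piece h f {(3, 2), (3, 3), (4, 3)} L1"
    and L2: "linear_piece h f {(3, 9), (3, 8), (4, 8)} L2"
    and v0: "\<And>x. x \<in> {h..4*h} \<Longrightarrow> \<bar>g x - quad h v0 x\<bar> \<le> K * h^3"
  shows "\<forall>n. invertible (jacobian (Q h L1 L2) (at (newton (Q h L1 L2) (Fbar h f) v0 n)))"
    and "\<exists>l. newton (Q h L1 L2) (Fbar h f) v0 \<longlonglongrightarrow> l \<and> Q h L1 L2 l = Fbar h f \<and>
      coeff_norm h (l - v0) \<le> 2 * (132 / \<delta> * ((20952 + 54000 * k) * m * h\<^sup>2))"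
proof -
  note l = local_settingD[OF ls h(1)]
  have hh: "h\<^sup>2 \<le> h" using h by (simp add: power2_eq_square mult_left_le)
  define e where "e = 1746 * m * h\<^sup>2"
  have e0: "0 \<le> e" using m by (simp add: e_def)
  have Me: "1746 * M * h\<^sup>2 \<le> e" unfolding e_def using m by (intro mult_right_mono) auto
  have eh: "e \<le> 1746 * m * h" unfolding e_def using m hh by (intro mult_left_mono) auto
  have mh: "m * h \<le> m" using h m by (simp add: mult_left_le)
  obtain a1 b1 c1 where L1_eq: "L1 = (\<lambda>(x, y). a1 * x + b1 * y + c1)" and ab1: "\<bar>a1\<bar> \<le> 195 * M" "\<bar>b1\<bar> \<le> 195 * M"
    and "\<forall>(x, y)\<in>{(x, y) \<in> window h. y \<le> g x}. \<bar>f1 (x, y) - (a1 * x + b1 * y + c1)\<bar> \<le> 1746 * M * h\<^sup>2"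
    using lower_piece_approx[OF ls h L1] by blast
  then have 1: "\<bar>f1 (x, y) - (a1 * x + b1 * y + c1)\<bar> \<le> e" if "(x, y) \<in> window h" "y \<le> g x" for x y
    using that Me by fastforce
  obtain a2 b2 c2 where L2_eq: "L2 = (\<lambda>(x, y). a2 * x + b2 * y + c2)" and ab2: "\<bar>a2\<bar> \<le> 195 * M" "\<bar>b2\<bar> \<le> 195 * M"
    and "\<forall>(x, y)\<in>{(x, y) \<in> window h. g x \<le> y}. \<bar>f2 (x, y) - (a2 * x + b2 * y + c2)\<bar> \<le> 1746 * M * h\<^sup>2"
    using upper_piece_approx[OF ls h L2] by blast
  then have 2: "\<bar>f2 (x, y) - (a2 * x + b2 * y + c2)\<bar> \<le> e" if "(x, y) \<in> window h" "g x \<le> y" for x y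
    using that Me by fastforce
  define \<alpha> \<beta> \<gamma> where "\<alpha> = a1 - a2" and "\<beta> = b1 - b2" and "\<gamma> = c1 - c2"
  have \<alpha>\<beta>: "\<bar>\<alpha>\<bar> \<le> 390 * m" "\<bar>\<beta>\<bar> \<le> 390 * m" using ab1 ab2 m by (simp_all add: \<alpha>_def \<beta>_def)
  define d0 where "d0 = \<alpha> * h + \<beta> * g h + \<gamma>"
  have gh: "3 * h \<le> g h" "g h \<le> 7 * h" using l(3,4)[of h] h by auto
  have hg: "(h, g h) \<in> window h" using gh h by (simp add: window_def)
  have d0_diff: "\<bar>d0 - (f1 (h, g h) - f2 (h, g h))\<bar> \<le> 2 * e"
    using 1[OF hg] 2[OF hg] by (simp add: d0_def \<alpha>_def \<beta>_def \<gamma>_def algebra_simps abs_le_iff)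
  have "\<delta> \<le> \<bar>f1 (h, g h) - f2 (h, g h)\<bar>" using l(11)[of h] h by simp
  with d0_diff eh h2 have d0_lower: "\<delta> / 2 \<le> \<bar>d0\<bar>" using \<delta> by linarith
  have "\<bar>f1 (h, g h)\<bar> \<le> M" "\<bar>f2 (h, g h)\<bar> \<le> M"
  proof -
    have "Ck_norm_le2 2 {(x, y) \<in> window h. y \<le> g x} f1 M" "Ck_norm_le2 2 {(x, y) \<in> window h. g x \<le> y} f2 M"
      using ls by (auto simp: local_setting_def)
    then show "\<bar>f1 (h, g h)\<bar> \<le> M" "\<bar>f2 (h, g h)\<bar> \<le> M"
      using hg by (auto dest!: Ck_norm_le2_imp_bounded)
  qed
  with d0_diff eh mh m have d0_upper: "\<bar>d0\<bar> \<le> 3494 * m" by linarith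
  \<comment> \<open>The distances to the base point are at most \<open>3 * h\<close> and
    \<open>(24 + 7) * h\<close>, and 13260 = 390 * (3 + 31).\<close>
  have near: "\<bar>\<alpha> * x + \<beta> * y + \<gamma> - d0\<bar> \<le> 13260 * m * h" if "x \<in> {h..4*h}" "\<bar>y\<bar> \<le> 24 * h" for x y
  proof -
    have "\<bar>\<alpha>\<bar> * \<bar>x - h\<bar> \<le> (390 * m) * (3 * h)" using that \<alpha>\<beta> m by (intro mult_mono) auto
    moreover have "\<bar>\<beta>\<bar> * \<bar>y - g h\<bar> \<le> (390 * m) * (31 * h)"
      using that \<alpha>\<beta> m gh h by (intro mult_mono) (auto simp: abs_le_iff)
    moreover have "\<bar>\<alpha> * x + \<beta> * y + \<gamma> - d0\<bar> \<le> \<bar>\<alpha>\<bar> * \<bar>x - h\<bar> + \<bar>\<beta>\<bar> * \<bar>y - g h\<bar>"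
      unfolding abs_mult[symmetric] d0_def using abs_triangle_ineq[of "\<alpha> * (x - h)" "\<beta> * (y - g h)"]
      by (simp add: algebra_simps)
    ultimately show ?thesis by linarith
  qed
  have Kk: "K * h^3 \<le> k * h^3" using k h by (intro mult_right_mono) auto
  have "k * h^3 \<le> h"
  proof -
    have "k * h^3 = (k * h) * h\<^sup>2" by (simp add: power2_eq_square power3_eq_cube)
    also have "\<dots> \<le> 1 * h\<^sup>2" using h1 by (intro mult_right_mono) auto
    finally show ?thesis using hh by simp
  qed
  with Kk v0 have gv: "\<bar>g x - quad h v0 x\<bar> \<le> h" if "x \<in> {h..4*h}" for x using that by fastforce
  have v0_bd: "\<bar>quad h v0 x\<bar> \<le> 8 * h" if "x \<in> {h..4*h}" for x
    using gv[OF that] l(3,4)[OF that] h by linarith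
  \<comment> \<open>The initial parabola is bounded by \<open>8 * h\<close>; moving by at most 1 in
    the coefficient norm adds \<open>16 * h\<close>.\<close>
  have v_bd: "\<bar>quad h v x\<bar> \<le> 24 * h" if "x \<in> {h..4*h}" "coeff_norm h (v - v0) \<le> 1" for x v
  proof -
    have "\<bar>quad h (v - v0) x\<bar> \<le> 16 * h * coeff_norm h (v - v0)" using that h by (intro abs_quad_le) auto
    also have "\<dots> \<le> 16 * h * 1" using that h by (intro mult_left_mono) auto
    finally show ?thesis using v0_bd[OF that(1)] by (simp add: quad_diff)
  qed
  have inv: "coeff_norm h w \<le> 132 / \<delta> * norm (Q_deriv h \<alpha> \<beta> \<gamma> v w)" if "coeff_norm h (v - v0) \<le> 1" for v w
  proof -
    have "coeff_norm h w \<le> 66 / (\<delta> / 2) * norm (Q_deriv h \<alpha> \<beta> \<gamma> v w)"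
      by (rule Q_deriv_lower_bound[OF h(1) _ d0_lower, of "13260 * m * h"])
        (use \<delta> h2 near v_bd that in auto)
    then show ?thesis by simp
  qed
  have res: "norm (Q h L1 L2 v0 - Fbar h f) \<le> (20952 + 54000 * k) * m * h\<^sup>2"
  proof -
    have "norm (Q h L1 L2 v0 - Fbar h f) \<le> 3 * (4 * e + 18000 * m * (k * h^3) / h)"
    proof (rule Q_residual_bound[OF ls h(1) L1_eq L2_eq 1 2 e0])
      fix x assume x: "x \<in> {h..4*h}"
      show "\<bar>g x - quad h v0 x\<bar> \<le> k * h^3" using v0[OF x] Kk by linarith
      have "\<bar>g x + quad h v0 x\<bar> \<le> 48 * h" using v0_bd[OF x] l(3,4)[OF x] h by linarith
      then have "\<bar>(g x + quad h v0 x) / 2\<bar> \<le> 24 * h" by simp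
      \<comment> \<open>The midpoint of the two heights is within the range of \<open>near\<close>,
        and 13260 + 3494 is at most 18000.\<close>
      from near[OF x this] d0_upper mh m
      show "\<bar>(a1 - a2) * x + (b1 - b2) * ((g x + quad h v0 x) / 2) + (c1 - c2)\<bar> \<le> 18000 * m"
        unfolding \<alpha>_def[symmetric] \<beta>_def[symmetric] \<gamma>_def[symmetric] by linarith
    qed
    also have "\<dots> = (20952 + 54000 * k) * m * h\<^sup>2"
      using h by (simp add: e_def power2_eq_square power3_eq_cube algebra_simps)
    finally show ?thesis .
  qed
  have rem: "norm (Q h L1 L2 (v + w) - Q h L1 L2 v - Q_deriv h \<alpha> \<beta> \<gamma> v w) \<le> 149760 * m * h * (coeff_norm h w)\<^sup>2" for v w
    using Q_expansion_bound[OF h(1) L1_eq L2_eq, of "390 * m" v w] \<alpha>\<beta> by (simp add: \<alpha>_def \<beta>_def \<gamma>_def)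
  have C: "0 \<le> 132 / \<delta>" using \<delta> by simp
  have init: "132 / \<delta> * norm (Q h L1 L2 v0 - Fbar h f) \<le> 132 / \<delta> * ((20952 + 54000 * k) * m * h\<^sup>2)"
    using res C by (rule mult_left_mono)
  have "132 / \<delta> * ((20952 + 54000 * k) * m * h\<^sup>2) \<le> 132 / \<delta> * ((20952 + 54000 * k) * m * h)"
    using C hh m k by (intro mult_left_mono) auto
  with h4 have half: "132 / \<delta> * ((20952 + 54000 * k) * m * h\<^sup>2) \<le> 1/2" by linarith
  have cont: "continuous_on UNIV (coeff_norm h)"
    unfolding coeff_norm_def [abs_def] by (intro continuous_intros)
  note newton = newton_quadratic_convergence[where N = "coeff_norm h" and G' = "Q_deriv h \<alpha> \<beta> \<gamma>",
      OF _ _ _ cont norm_le_coeff_norm linear_Q_deriv _ C rem coeff_norm_le_norm inv init half h3]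
  show "\<forall>n. invertible (jacobian (Q h L1 L2) (at (newton (Q h L1 L2) (Fbar h f) v0 n)))"
    by (rule newton(1)) (use h m in \<open>auto simp: coeff_norm_triangle\<close>, auto simp: coeff_norm_def)
  show "\<exists>l. newton (Q h L1 L2) (Fbar h f) v0 \<longlonglongrightarrow> l \<and> Q h L1 L2 l = Fbar h f \<and>
      coeff_norm h (l - v0) \<le> 2 * (132 / \<delta> * ((20952 + 54000 * k) * m * h\<^sup>2))"
    by (rule newton(2)) (use h m in \<open>auto simp: coeff_norm_triangle\<close>, auto simp: coeff_norm_def)
qed

theorem mainTheorem3:
  fixes M \<delta> B K :: real
  assumes "\<delta> > 0"
  shows "\<exists>h0>0. \<exists>C. \<forall>h g f1 f2 f L1 L2 a0 b0 c0.
    0 < h \<longrightarrow> h < h0 \<longrightarrow>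
    local_setting M \<delta> h g f1 f2 f \<longrightarrow>
    linear_piece h f {(3,2), (3,3), (4,3)} L1 \<longrightarrow>
    linear_piece h f {(3,9), (3,8), (4,8)} L2 \<longrightarrow>
    \<bar>a0\<bar> \<le> B \<longrightarrow> \<bar>b0\<bar> \<le> B \<longrightarrow> \<bar>c0\<bar> \<le> B \<longrightarrow>
    (\<forall>x\<in>{h..4*h}. \<bar>g x - quad h (vector [a0, b0, c0]) x\<bar> \<le> K * h^3) \<longrightarrow>
    (let v = newton (Q h L1 L2) (Fbar h f) (vector [a0, b0, c0]) in
      (\<forall>n. invertible (jacobian (Q h L1 L2) (at (v n)))) \<and>
      (\<exists>a b c. v \<longlonglongrightarrow> vector [a, b, c] \<and>
        (\<forall>i\<in>{2,3,4}. Q_comp h L1 L2 i (vector [a, b, c]) =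
           cell_avg h f i 4 + cell_avg h f i 5 + cell_avg h f i 6 + cell_avg h f i 7) \<and>
        (\<forall>x\<in>{2*h..3*h}. \<bar>quad h (vector [a, b, c]) x - g x\<bar> \<le> C * h^3)))"
proof -
  \<comment> \<open>Replacing the given bounds by numbers at least 1 keeps all quotients below
    positive, whatever the signs of \<open>M\<close> and \<open>K\<close>.\<close>
  define m where "m = \<bar>M\<bar> + 1"
  define k where "k = \<bar>K\<bar> + 1"
  have m: "M \<le> m" "1 \<le> m" and k: "K \<le> k" "1 \<le> k" by (auto simp: m_def k_def)
  define R where "R = 132 / \<delta> * ((20952 + 54000 * k) * m)"
  \<comment> \<open>One entry for each smallness condition of \<open>newton_limit_estimate\<close>;
    the last makes \<open>R * h \<le> 1/2\<close>.\<close>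
  define h0 where "h0 = Min {1, 1 / k, \<delta> / (28005120 * m), 1 / (132 / \<delta> * (149760 * m)), 1 / (2 * R)}"
  have R: "0 < R" using assms m k by (simp add: R_def)
  have h0: "0 < h0" using assms m k R unfolding h0_def by (subst Min_gr_iff) auto
  show ?thesis
  \<comment> \<open>The limit lies within \<open>2 * R * h^2\<close> of the start in the coefficient
    norm, which moves the parabola by at most \<open>16 * h\<close> times this; \<open>k\<close>
    accounts for the error of the initial parabola.\<close>
  proof (rule exI[of _ h0], rule conjI[OF h0], rule exI[of _ "32 * R + k"], intro allI impI)
    fix h g f1 f2 f L1 L2 a0 b0 c0
    assume h: "0 < h" "h < h0" and ls: "local_setting M \<delta> h g f1 f2 f"
      and L1: "linear_piece h f {(3,2), (3,3), (4,3)} L1" and L2: "linear_piece h f {(3,9), (3,8), (4,8)} L2"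
      and g: "\<forall>x\<in>{h..4*h}. \<bar>g x - quad h (vector [a0, b0, c0]) x\<bar> \<le> K * h^3"
    define v0 :: "real^3" where "v0 = vector [a0, b0, c0]"
    have "h \<le> 1" "h \<le> 1 / k" "h \<le> \<delta> / (28005120 * m)" "h \<le> 1 / (132 / \<delta> * (149760 * m))" "h \<le> 1 / (2 * R)"
      using h(2) unfolding h0_def by (subst (asm) Min_gr_iff; simp)+
    then have hs: "h \<le> 1" "k * h \<le> 1" "28005120 * m * h \<le> \<delta>" "132 / \<delta> * (149760 * m * h) \<le> 1"
        "132 / \<delta> * ((20952 + 54000 * k) * m * h) \<le> 1/2"
      using R m k assms by (simp_all add: R_def field_simps)
    have v0: "\<bar>g x - quad h v0 x\<bar> \<le> K * h^3" if "x \<in> {h..4*h}" for x using g that by (simp add: v0_def)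
    note nl = newton_limit_estimate[OF assms h(1) hs(1) m k hs(2-5) ls L1 L2 v0]
    obtain l where lim: "newton (Q h L1 L2) (Fbar h f) v0 \<longlonglongrightarrow> l" and sol: "Q h L1 L2 l = Fbar h f"
      and close: "coeff_norm h (l - v0) \<le> 2 * (R * h\<^sup>2)"
      using nl(2) by (auto simp: R_def mult.assoc)
    have l_eq: "vector [l$1, l$2, l$3] = l" by (simp add: vec_eq_iff forall_3 vector_3)
    have "\<forall>i\<in>{2,3,4}. Q_comp h L1 L2 i l = cell_avg h f i 4 + cell_avg h f i 5 + cell_avg h f i 6 + cell_avg h f i 7"
      using sol by (simp add: Q_def Fbar_def vec_eq_iff forall_3 vector_3 col_data_def)
    moreover have "\<bar>quad h l x - g x\<bar> \<le> (32 * R + k) * h^3" if "x \<in> {2*h..3*h}" for x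
    proof -
      have "\<bar>quad h (l - v0) x\<bar> \<le> 16 * h * coeff_norm h (l - v0)" using that h by (intro abs_quad_le) auto
      also have "\<dots> \<le> 16 * h * (2 * (R * h\<^sup>2))" using close h by (intro mult_left_mono) auto
      finally have "\<bar>quad h l x - quad h v0 x\<bar> \<le> 32 * R * h^3"
        by (simp add: quad_diff power2_eq_square power3_eq_cube mult_ac)
      moreover have "\<bar>g x - quad h v0 x\<bar> \<le> K * h^3" using v0[of x] that h by simp
      moreover have "K * h^3 \<le> k * h^3" using k h by (intro mult_right_mono) auto
      ultimately show ?thesis unfolding distrib_right by linarith
    qed
    ultimately have "newton (Q h L1 L2) (Fbar h f) v0 \<longlonglongrightarrow> vector [l$1, l$2, l$3] \<and>
        (\<forall>i\<in>{2,3,4}. Q_comp h L1 L2 i (vector [l$1, l$2, l$3]) =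
           cell_avg h f i 4 + cell_avg h f i 5 + cell_avg h f i 6 + cell_avg h f i 7) \<and>
        (\<forall>x\<in>{2*h..3*h}. \<bar>quad h (vector [l$1, l$2, l$3]) x - g x\<bar> \<le> (32 * R + k) * h^3)"
      using lim by (simp add: l_eq)
    with nl(1) show "let v = newton (Q h L1 L2) (Fbar h f) (vector [a0, b0, c0]) in
      (\<forall>n. invertible (jacobian (Q h L1 L2) (at (v n)))) \<and>
      (\<exists>a b c. v \<longlonglongrightarrow> vector [a, b, c] \<and>
        (\<forall>i\<in>{2,3,4}. Q_comp h L1 L2 i (vector [a, b, c]) =
           cell_avg h f i 4 + cell_avg h f i 5 + cell_avg h f i 6 + cell_avg h f i 7) \<and>
        (\<forall>x\<in>{2*h..3*h}. \<bar>quad h (vector [a, b, c]) x - g x\<bar> \<le> (32 * R + k) * h^3))"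
      unfolding Let_def v0_def[symmetric] by blast
  qed
qed

end
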